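(* Let $p>2$ be real. The function $$Z_p(z)=\sum_{n=2}^\infty\zeta_n(p)z^n,\qquad \zeta_n(p)=\sum_{1\le k_1<k_2<\dots<k_n}(k_2-k_1)(k_3-k_2)\cdots(k_n-k_{n-1})(k_1k_2\cdots k_n)^{-p},$$ has the same order $1/p$ and the same type $\tau_p$ as the function $$G_p(z)=\sum_{n=1}^\infty\gamma_n(p)z^n,\qquad \gamma_n(p)=\sum_{1\le k_1\le k_2<k_3\le k_4<\dots<k_{2n-1}\le k_{2n}}(k_1k_2\cdots k_{2n-1}k_{2n})^{-p/2}.$$
   Context: All summation indices are positive integers. In $\gamma_n(p)$ the inequalities alternate: $k_{2j-1}\le k_{2j}$ and $k_{2j}<k_{2j+1}$. Here $\tau_p$ denotes the type of $G_p$. For a non-constant entire function $f(z)=\sum c_nz^n$ with $\mathcal M_f(r)=\max_{|z|=r}|f(z)|$, the order is $\rho_f=\limsup_{r\to\infty}\frac{\log\log\mathcal M_f(r)}{\log r}=\limsup_{n\to\infty}\frac{\log n}{\log(1/\sqrt[n]{|c_n|})}$, and if $0<\rho_f<\infty$ the type is $\tau_f=\limsup_{r\to\infty}\frac{\log\mathcal M_f(r)}{r^{\rho_f}}=\frac1{e\rho_f}\limsup_{n\to\infty}\left(n|c_n|^{\rho_f/n}\right)$. *)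

theory Defs
  imports "HOL-Complex_Analysis.Complex_Analysis"
begin

definition max_modulus :: "(complex \<Rightarrow> complex) \<Rightarrow> real \<Rightarrow> real" where
  "max_modulus f r = (SUP z\<in>sphere 0 r. cmod (f z))"

(* Growth order and type of an entire function.  Both are meaningful only for
   non-constant entire f, where max_modulus f r tends to infinity, so that the
   totalized real logarithms below are eventually the genuine ones.  The type
   additionally requires the order to lie strictly between 0 and infinity. *)

definition growth_order :: "(complex \<Rightarrow> complex) \<Rightarrow> ereal" where
  "growth_order f = Limsup at_top (\<lambda>r. ereal (ln (ln (max_modulus f r)) / ln r))"

definition growth_type :: "(complex \<Rightarrow> complex) \<Rightarrow> ereal" where
  "growth_type f =
     Limsup at_top (\<lambda>r. ereal (ln (max_modulus f r) / r powr real_of_ereal (growth_order f)))"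

(* Index tuples (k_1, ..., k_m) of positive integers are extensional functions
   on {1..m}, so that each tuple is counted exactly once. *)

definition zeta_indices :: "nat \<Rightarrow> (nat \<Rightarrow> nat) set" where
  "zeta_indices n = {k \<in> {1..n} \<rightarrow>\<^sub>E {1..}. \<forall>i\<in>{1..<n}. k i < k (i + 1)}"

definition zeta_term :: "nat \<Rightarrow> real \<Rightarrow> (nat \<Rightarrow> nat) \<Rightarrow> real" where
  "zeta_term n p k =
     (\<Prod>i=1..<n. real (k (i + 1)) - real (k i)) * (\<Prod>i=1..n. real (k i)) powr (- p)"

definition zeta_coeff :: "nat \<Rightarrow> real \<Rightarrow> real" where
  "zeta_coeff n p = (\<Sum>\<^sub>\<infinity>k\<in>zeta_indices n. zeta_term n p k)"

definition Z_fun :: "real \<Rightarrow> complex \<Rightarrow> complex" where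
  "Z_fun p z = (\<Sum>\<^sub>\<infinity>n\<in>{2..}. complex_of_real (zeta_coeff n p) * z ^ n)"

definition gamma_indices :: "nat \<Rightarrow> (nat \<Rightarrow> nat) set" where
  "gamma_indices n = {k \<in> {1..2*n} \<rightarrow>\<^sub>E {1..}.
     (\<forall>j\<in>{1..n}. k (2*j - 1) \<le> k (2*j)) \<and> (\<forall>j\<in>{1..<n}. k (2*j) < k (2*j + 1))}"

definition gamma_term :: "nat \<Rightarrow> real \<Rightarrow> (nat \<Rightarrow> nat) \<Rightarrow> real" where
  "gamma_term n p k = (\<Prod>i=1..2*n. real (k i)) powr (- p / 2)"

definition gamma_coeff :: "nat \<Rightarrow> real \<Rightarrow> real" where
  "gamma_coeff n p = (\<Sum>\<^sub>\<infinity>k\<in>gamma_indices n. gamma_term n p k)"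

definition G_fun :: "real \<Rightarrow> complex \<Rightarrow> complex" where
  "G_fun p z = (\<Sum>\<^sub>\<infinity>n\<in>{1..}. complex_of_real (gamma_coeff n p) * z ^ n)"

end

theory Submission
  imports Defs
begin

text \<open>
  A difference k' - k of positive integers counts the integers b with k \<le> b < k'. So the
  \<zeta>-sum runs over interlaced tuples a_1 \<le> b_1 < a_2 \<le> b_2 < ... < a_n in which only the
  a_i are weighted, each by a_i powr (-p), whereas the \<gamma>-sum runs over almost the same tuples
  (with one more entry b_n) and splits the weight as (a_i b_i) powr (-p/2). Let Z_n(a) and \<Gamma>_n(a) be
  the parts of these sums in which the last a-entry, a_n, equals a. Since b_i lies between a_i and
  a_{i+1}, shifting half of the weight from an entry to its neighbour gives
  Z_n(a) \<le> \<Gamma>_n(a) \<le> a powr (p/2) * Z_n(a)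
  (\<open>zeta_last_le_gamma_last\<close>, \<open>gamma_last_le_zeta_last\<close>).

  The loss of a power of the last entry is harmless, because appending further entries to a tuple
  is summable and even gains a factor a powr (-\<epsilon>) each time; this is where p > 2 enters
  (\<open>kernel_iteration_decay\<close>). After a fixed number j of extra entries the loss is absorbed, so
  \<zeta>_{n+j} \<le> C \<gamma>_n and \<gamma>_{n+i} \<le> D \<zeta>_n for all n
  (\<open>zeta_coeff_shift_le\<close>, \<open>gamma_coeff_shift_le\<close>).

  All coefficients are nonnegative, so the maximum modulus on |z| = r is the value at r, and the two
  inequalities bound each function by a power of r times the other one. Hence the logarithms of
  the two maximum moduli differ by O(ln r) (\<open>ln_diff_bigo_ln\<close>), which is o(r powr (1/p)): the orders
  agree, and once the order is known to be 1/p, so do the types (\<open>log_perturbation\<close>).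

  For the order, the single tuple (1, 2, ..., n) gives \<zeta>_n \<ge> (n!) powr (-p), hence the lower bound 1/p.
  For the upper bound, \<gamma>_n x^(2n) is at most the square of the product of the factors
  1 + x k powr (-p/2), because the odd and the even positions of an admissible tuple are both
  strictly increasing (\<open>gamma_partial_le_product\<close>); this product has order 2/p in x, and x^2 = z.

  Every infinite sum over tuples is approached through the finite sums in which the last, and hence
  every, entry is at most N. All inequalities are proved for these, uniformly in N.
\<close>

section \<open>Sums over tuples, organised by their last entry\<close>

text \<open>
  The relation between neighbouring entries may depend on the position, since the inequalities
  in the \<gamma>-sum alternate between weak and strict ones.
\<close>

definition chain_indices :: "(nat \<Rightarrow> nat \<Rightarrow> nat \<Rightarrow> bool) \<Rightarrow> nat \<Rightarrow> (nat \<Rightarrow> nat) set" where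
  "chain_indices R n = {k \<in> {1..n} \<rightarrow>\<^sub>E {1..}. \<forall>i\<in>{1..<n}. R i (k i) (k (i + 1))}"

definition chain_weight :: "(nat \<Rightarrow> nat \<Rightarrow> real) \<Rightarrow> (nat \<Rightarrow> real) \<Rightarrow> nat \<Rightarrow> (nat \<Rightarrow> nat) \<Rightarrow> real" where
  "chain_weight w v n k = (\<Prod>i=1..<n. w (k i) (k (i + 1))) * (\<Prod>i=1..n. v (k i))"

text \<open>
  The value at n and a belongs to the tuples of length n + 1 with last entry a: a tuple has at
  least one entry, which is what the base case 0 describes.
\<close>

primrec chain_sum ::
  "(nat \<Rightarrow> nat \<Rightarrow> nat \<Rightarrow> bool) \<Rightarrow> (nat \<Rightarrow> nat \<Rightarrow> real) \<Rightarrow> (nat \<Rightarrow> real) \<Rightarrow> nat \<Rightarrow> nat \<Rightarrow> real" where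
  "chain_sum R w v 0 a = v a"
| "chain_sum R w v (Suc n) a =
     v a * (\<Sum>b\<in>{b\<in>{1..a}. R (Suc n) b a}. w b a * chain_sum R w v n b)"

locale weighted_chains =
  fixes R :: "nat \<Rightarrow> nat \<Rightarrow> nat \<Rightarrow> bool" and w :: "nat \<Rightarrow> nat \<Rightarrow> real" and v :: "nat \<Rightarrow> real"
  assumes R_le: "\<And>i x y. R i x y \<Longrightarrow> x \<le> y"
    and w_nonneg: "\<And>i x y. R i x y \<Longrightarrow> 0 \<le> w x y"
    and v_nonneg: "\<And>x. 0 \<le> v x"
begin

abbreviation "S \<equiv> chain_sum R w v"

lemma chain_sum_nonneg: "0 \<le> S n a"
  by (induction n arbitrary: a) (auto intro!: mult_nonneg_nonneg sum_nonneg v_nonneg w_nonneg)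

lemma chain_weight_nonneg: "k \<in> chain_indices R n \<Longrightarrow> 0 \<le> chain_weight w v n k"
  unfolding chain_weight_def chain_indices_def
  by (intro mult_nonneg_nonneg prod_nonneg) (auto intro: v_nonneg w_nonneg)

definition ending :: "nat \<Rightarrow> nat \<Rightarrow> (nat \<Rightarrow> nat) set" where
  "ending n a = {k \<in> chain_indices R (Suc n). k (Suc n) = a}"

text \<open>
  Deleting the last entry leaves a tuple that ends in an admissible predecessor. As tuples are
  extensional functions, appending an entry is a function update at a position where the shorter
  tuple is undefined.
\<close>

lemma ending_Suc:
  assumes "1 \<le> a"
  shows "ending (Suc n) a =
    (\<Union>b\<in>{b\<in>{1..a}. R (Suc n) b a}. (\<lambda>k. k(Suc (Suc n) := a)) ` ending n b)"
    (is "_ = ?U")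
proof (intro set_eqI iffI)
  fix k assume k: "k \<in> ending (Suc n) a"
  define k' where "k' = k(Suc (Suc n) := undefined)"
  have ex: "k \<in> {1..Suc (Suc n)} \<rightarrow>\<^sub>E {1..}" and st: "\<And>i. i \<in> {1..<Suc (Suc n)} \<Longrightarrow> R i (k i) (k (i+1))"
    and ka: "k (Suc (Suc n)) = a"
    using k by (auto simp: ending_def chain_indices_def)
  have "k' \<in> ending n (k (Suc n))"
    using ex st by (auto simp: ending_def chain_indices_def k'_def PiE_iff extensional_def)
  moreover have "k = k'(Suc (Suc n) := a)" by (simp add: k'_def flip: ka)
  moreover have "R (Suc n) (k (Suc n)) a" using st[of "Suc n"] ka by auto
  moreover have "1 \<le> k (Suc n)" using ex by (auto simp: PiE_iff)
  ultimately show "k \<in> ?U" using R_le by (auto intro!: bexI[of _ "k (Suc n)"])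
next
  fix k assume "k \<in> ?U"
  then show "k \<in> ending (Suc n) a" using assms
    by (auto simp: ending_def chain_indices_def PiE_iff extensional_def less_Suc_eq)
qed

lemma ending_0: "1 \<le> a \<Longrightarrow> ending 0 a = {(\<lambda>i. undefined)(1 := a)}"
  by (auto simp: ending_def chain_indices_def PiE_iff extensional_def fun_eq_iff)

lemma finite_ending: "1 \<le> a \<Longrightarrow> finite (ending n a)"
proof (induction n arbitrary: a)
  case 0
  then show ?case by (simp add: ending_0)
next
  case (Suc n)
  then show ?case by (subst ending_Suc) auto
qed

lemma sum_ending: "1 \<le> a \<Longrightarrow> sum (chain_weight w v (Suc n)) (ending n a) = S n a"
proof (induction n arbitrary: a)
  case 0
  then show ?case by (simp add: ending_0 chain_weight_def)
next
  case (Suc n)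
  let ?B = "{b\<in>{1..a}. R (Suc n) b a}" and ?u = "\<lambda>k::nat\<Rightarrow>nat. k(Suc (Suc n) := a)"
  have inj: "inj_on ?u (ending n b)" for b
  proof (rule inj_onI)
    fix k l assume "k \<in> ending n b" "l \<in> ending n b" and eq: "?u k = ?u l"
    then have "k (Suc (Suc n)) = undefined" "l (Suc (Suc n)) = undefined"
      by (auto simp: ending_def chain_indices_def PiE_iff extensional_def)
    moreover have "k i = l i" if "i \<noteq> Suc (Suc n)" for i
      using fun_cong[OF eq, of i] that by simp
    ultimately show "k = l" by (metis ext)
  qed
  have "sum (chain_weight w v (Suc (Suc n))) (ending (Suc n) a)
      = (\<Sum>b\<in>?B. sum (chain_weight w v (Suc (Suc n))) (?u ` ending n b))"
    unfolding ending_Suc[OF Suc.prems]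
    by (rule sum.UNION_disjoint)
       (auto intro!: finite_ending, auto simp: ending_def fun_eq_iff split: if_splits
          dest: spec[of _ "Suc n"])
  also have "\<dots> = (\<Sum>b\<in>?B. v a * (w b a * S n b))"
  proof (rule sum.cong[OF refl])
    fix b assume b: "b \<in> ?B"
    have "sum (chain_weight w v (Suc (Suc n))) (?u ` ending n b)
        = (\<Sum>k\<in>ending n b. chain_weight w v (Suc (Suc n)) (?u k))"
      by (simp add: sum.reindex[OF inj])
    also have "\<dots> = (\<Sum>k\<in>ending n b. v a * w b a * chain_weight w v (Suc n) k)"
    proof (rule sum.cong[OF refl])
      fix k assume "k \<in> ending n b"
      then have kb: "k (Suc n) = b" by (simp add: ending_def)
      have "(\<Prod>i=1..<Suc n. w (?u k i) (?u k (i+1))) = (\<Prod>i=1..<Suc n. w (k i) (k (i+1)))"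
        "(\<Prod>i=1..Suc n. v (?u k i)) = (\<Prod>i=1..Suc n. v (k i))"
        by (auto intro!: prod.cong)
      then show "chain_weight w v (Suc (Suc n)) (?u k) = v a * w b a * chain_weight w v (Suc n) k"
        using kb by (simp add: chain_weight_def)
    qed
    also have "\<dots> = v a * (w b a * S n b)"
      using Suc.IH[of b] b by (simp add: mult.assoc flip: sum_distrib_left)
    finally show "sum (chain_weight w v (Suc (Suc n))) (?u ` ending n b) = v a * (w b a * S n b)" .
  qed
  finally show ?case by (simp add: sum_distrib_left)
qed

text \<open>
  The entries are weakly increasing, so a bound on the last one bounds them all. This makes the
  truncated index sets finite, and every finite set of tuples lies in one of them.
\<close>

lemma finite_sum_chains:
  defines "T \<equiv> \<lambda>n N. \<Union>a\<in>{1..N}. ending n a"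
  shows "finite (T n N)" and "sum (chain_weight w v (Suc n)) (T n N) = (\<Sum>a=1..N. S n a)"
    and "T n N \<subseteq> chain_indices R (Suc n)"
    and "finite F \<Longrightarrow> F \<subseteq> chain_indices R (Suc n) \<Longrightarrow> \<exists>N. F \<subseteq> T n N"
proof -
  show "finite (T n N)" unfolding T_def by (auto intro: finite_ending)
  have "sum (chain_weight w v (Suc n)) (T n N) = (\<Sum>a=1..N. sum (chain_weight w v (Suc n)) (ending n a))"
    unfolding T_def
    by (rule sum.UNION_disjoint) (auto intro!: finite_ending, auto simp: ending_def)
  also have "\<dots> = (\<Sum>a=1..N. S n a)" by (intro sum.cong) (auto simp: sum_ending)
  finally show "sum (chain_weight w v (Suc n)) (T n N) = (\<Sum>a=1..N. S n a)" .
  show "T n N \<subseteq> chain_indices R (Suc n)" by (auto simp: T_def ending_def)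
  assume F: "finite F" "F \<subseteq> chain_indices R (Suc n)"
  have "F \<subseteq> T n (Max ((\<lambda>k. k (Suc n)) ` F))"
  proof
    fix k assume k: "k \<in> F"
    have "k (Suc n) \<le> Max ((\<lambda>k. k (Suc n)) ` F)" using F k by auto
    moreover have "1 \<le> k (Suc n)" using F k by (auto simp: chain_indices_def PiE_iff)
    ultimately show "k \<in> T n (Max ((\<lambda>k. k (Suc n)) ` F))"
      using F k by (auto simp: T_def ending_def)
  qed
  then show "\<exists>N. F \<subseteq> T n N" ..
qed

text \<open>
  For nonnegative weights, the truncated sums decide summability, and their bounds pass to the
  infinite sum. All facts about infinite sums over tuples are drawn from the recursion in this way.
\<close>

lemma chain_summable:
  assumes "\<And>N. (\<Sum>a=1..N. S n a) \<le> B"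
  shows "chain_weight w v (Suc n) summable_on chain_indices R (Suc n)"
    and "infsum (chain_weight w v (Suc n)) (chain_indices R (Suc n)) \<le> B"
    and "(\<Sum>a=1..N. S n a) \<le> infsum (chain_weight w v (Suc n)) (chain_indices R (Suc n))"
proof -
  have bd: "sum (chain_weight w v (Suc n)) F \<le> B" if F: "finite F" "F \<subseteq> chain_indices R (Suc n)" for F
  proof -
    obtain N where "F \<subseteq> (\<Union>a\<in>{1..N}. ending n a)" using finite_sum_chains(4)[OF F] ..
    then have "sum (chain_weight w v (Suc n)) F \<le> (\<Sum>a=1..N. S n a)"
      unfolding finite_sum_chains(2)[symmetric]
      by (intro sum_mono2 finite_sum_chains(1))
         (use chain_weight_nonneg finite_sum_chains(3) in blast)+
    with assms[of N] show ?thesis by linarith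
  qed
  show sm: "chain_weight w v (Suc n) summable_on chain_indices R (Suc n)"
    using bd by (intro nonneg_bdd_above_summable_on chain_weight_nonneg bdd_aboveI2[where M=B]) auto
  show "infsum (chain_weight w v (Suc n)) (chain_indices R (Suc n)) \<le> B"
    using sm bd by (rule infsum_le_finite_sums)
  show "(\<Sum>a=1..N. S n a) \<le> infsum (chain_weight w v (Suc n)) (chain_indices R (Suc n))"
    unfolding finite_sum_chains(2)[symmetric]
    by (intro finite_sum_le_infsum sm finite_sum_chains(1,3) chain_weight_nonneg) auto
qed

end

section \<open>Decay of iterated kernels\<close>

lemma bounded_powr_sums:
  assumes "1 < u"
  obtains H where "0 \<le> H" "\<And>A. finite A \<Longrightarrow> (\<Sum>a\<in>A. real a powr (- u)) \<le> H"
proof -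
  have "summable (\<lambda>n. real n powr (- u))" using assms by (simp add: summable_real_powr_iff)
  then show ?thesis
    by (intro that[of "\<Sum>n. real n powr (- u)"] sum_le_suminf suminf_nonneg) auto
qed

lemma sum_triangle_swap:
  fixes f :: "nat \<Rightarrow> nat \<Rightarrow> 'a::comm_monoid_add"
  shows "(\<Sum>a=1..N. \<Sum>k=1..<a. f k a) = (\<Sum>k=1..N. \<Sum>a\<in>{k<..N}. f k a)"
proof -
  have "(\<Sum>a=1..N. \<Sum>k=1..<a. f k a) = (\<Sum>a=1..N. \<Sum>k\<in>{k\<in>{1..N}. k < a}. f k a)"
    by (intro sum.cong) auto
  also have "\<dots> = (\<Sum>k=1..N. \<Sum>a\<in>{a\<in>{1..N}. k < a}. f k a)"
    by (rule sum.swap_restrict) auto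
  also have "\<dots> = (\<Sum>k=1..N. \<Sum>a\<in>{k<..N}. f k a)"
    by (intro sum.cong) auto
  finally show ?thesis .
qed

text \<open>
  Split the kernel bound into a powr (-\<epsilon>) and a powr (-1 - \<epsilon>). The second factor is summable over a.
  The first one, together with any weight a powr (-x), is at most its value at the smaller
  index k. So one application of the kernel turns the weight -x into -(x + \<epsilon>) at bounded cost,
  and j applications yield the weight -j \<epsilon>.
\<close>

lemma kernel_iteration_decay:
  fixes X :: "nat \<Rightarrow> nat \<Rightarrow> real" and K :: "nat \<Rightarrow> nat \<Rightarrow> real"
  assumes X: "\<And>n a. 0 \<le> X n a"
    and step: "\<And>n a. X (Suc n) a = (\<Sum>k=1..<a. K k a * X n k)"
    and K: "\<And>k a. 1 \<le> k \<Longrightarrow> k < a \<Longrightarrow> K k a \<le> D * real a powr (- 1 - 2 * \<epsilon>)"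
    and D: "0 \<le> D" and e: "0 < \<epsilon>"
  obtains C where "0 < C" and "\<And>n N. (\<Sum>a=1..N. X (n + j) a) \<le> C * (\<Sum>k=1..N. real k powr (- (j * \<epsilon>)) * X n k)"
proof -
  obtain H where H: "0 \<le> H" "\<And>A. finite A \<Longrightarrow> (\<Sum>a\<in>A. real a powr (- (1 + \<epsilon>))) \<le> H"
    using bounded_powr_sums[of "1 + \<epsilon>"] e by auto
  \<comment> \<open>the summand 1 keeps the constant positive when D or H is 0\<close>
  define B where "B = D * H + 1"
  have B: "0 < B" "D * H \<le> B" using D H by (auto simp: B_def add_nonneg_pos)
  have shift: "(\<Sum>a=1..N. real a powr (- x) * X (Suc n) a) \<le> B * (\<Sum>k=1..N. real k powr (- (x + \<epsilon>)) * X n k)"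
    if "0 \<le> x" for x n N
  proof -
    have "(\<Sum>a=1..N. real a powr (- x) * X (Suc n) a)
        = (\<Sum>a=1..N. \<Sum>k=1..<a. real a powr (- x) * K k a * X n k)"
      by (simp add: step sum_distrib_left mult.assoc)
    also have "\<dots> = (\<Sum>k=1..N. \<Sum>a\<in>{k<..N}. real a powr (- x) * K k a * X n k)"
      by (rule sum_triangle_swap)
    also have "\<dots> \<le> (\<Sum>k=1..N. \<Sum>a\<in>{k<..N}. D * real k powr (- (x + \<epsilon>)) * X n k * real a powr (- (1 + \<epsilon>)))"
    proof (intro sum_mono)
      fix k a assume "k \<in> {1..N}" "a \<in> {k<..N}"
      then have k: "1 \<le> k" "k < a" by auto
      have "real a powr (- x) * K k a \<le> real a powr (- x) * (D * real a powr (- 1 - 2 * \<epsilon>))"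
        by (intro mult_left_mono K k) auto
      also have "\<dots> = D * (real a powr (- (x + \<epsilon>)) * real a powr (- (1 + \<epsilon>)))"
        by (simp add: algebra_simps flip: powr_add)
      also have "\<dots> \<le> D * (real k powr (- (x + \<epsilon>)) * real a powr (- (1 + \<epsilon>)))"
        using k D e that by (intro mult_left_mono mult_right_mono powr_mono2') auto
      finally have "real a powr (- x) * K k a * X n k
          \<le> D * (real k powr (- (x + \<epsilon>)) * real a powr (- (1 + \<epsilon>))) * X n k"
        by (rule mult_right_mono) (rule X)
      then show "real a powr (- x) * K k a * X n k
          \<le> D * real k powr (- (x + \<epsilon>)) * X n k * real a powr (- (1 + \<epsilon>))"
        by (simp add: mult_ac)
    qed
    also have "\<dots> = (\<Sum>k=1..N. real k powr (- (x + \<epsilon>)) * X n k * (D * (\<Sum>a\<in>{k<..N}. real a powr (- (1 + \<epsilon>)))))"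
      by (simp add: sum_distrib_left mult_ac)
    also have "\<dots> \<le> (\<Sum>k=1..N. real k powr (- (x + \<epsilon>)) * X n k * B)"
      by (intro sum_mono mult_left_mono mult_nonneg_nonneg X order_trans[OF mult_left_mono[OF H(2) D] B(2)]) auto
    also have "\<dots> = B * (\<Sum>k=1..N. real k powr (- (x + \<epsilon>)) * X n k)"
      by (simp add: sum_distrib_left mult_ac)
    finally show ?thesis .
  qed
  have iter: "(\<Sum>a=1..N. real a powr (- x) * X (n + j) a) \<le> B ^ j * (\<Sum>k=1..N. real k powr (- (x + j * \<epsilon>)) * X n k)"
    if "0 \<le> x" for x n N
    using that
  proof (induction j arbitrary: x)
    case 0
    then show ?case by simp
  next
    case (Suc j)
    have "(\<Sum>a=1..N. real a powr (- x) * X (n + Suc j) a)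
        \<le> B * (\<Sum>k=1..N. real k powr (- (x + \<epsilon>)) * X (n + j) k)"
      using shift[OF Suc.prems] by simp
    also have "\<dots> \<le> B * (B ^ j * (\<Sum>k=1..N. real k powr (- (x + \<epsilon> + j * \<epsilon>)) * X n k))"
      using B e Suc.prems by (intro mult_left_mono Suc.IH) auto
    finally show ?case by (simp add: algebra_simps)
  qed
  have "(\<Sum>a=1..N. X (n + j) a) \<le> B ^ j * (\<Sum>k=1..N. real k powr (- (j * \<epsilon>)) * X n k)" for n N
  proof -
    have "(\<Sum>a=1..N. X (n + j) a) = (\<Sum>a=1..N. real a powr (- 0) * X (n + j) a)"
      by (intro sum.cong) auto
    then show ?thesis using iter[of 0 n N] by simp
  qed
  then show ?thesis using B(1) by (intro that[of "B ^ j"]) auto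
qed

section \<open>Comparison of the two families for a fixed last entry\<close>

text \<open>
  By the length convention of \<^const>\<open>chain_sum\<close>, index n belongs to the tuples of length n + 1, so
  to the coefficient \<zeta>_{n+1}.
\<close>

definition zeta_last :: "real \<Rightarrow> nat \<Rightarrow> nat \<Rightarrow> real" where
  "zeta_last p = chain_sum (\<lambda>_. (<)) (\<lambda>x y. real y - real x) (\<lambda>a. real a powr (- p))"

text \<open>
  Index 2n belongs to the tuples of odd length 2n + 1, which end in an entry with an odd position;
  index 2n + 1 belongs to the coefficient \<gamma>_{n+1}.
\<close>

definition gamma_last :: "real \<Rightarrow> nat \<Rightarrow> nat \<Rightarrow> real" where
  "gamma_last p = chain_sum (\<lambda>i. if odd i then (\<le>) else (<)) (\<lambda>_ _. 1) (\<lambda>a. real a powr (- (p / 2)))"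

interpretation zeta: weighted_chains "\<lambda>_. (<)" "\<lambda>x y. real y - real x" "\<lambda>a. real a powr (- p)" for p
  by unfold_locales auto

interpretation gamma: weighted_chains "\<lambda>i. if odd i then (\<le>) else (<)" "\<lambda>_ _. 1" "\<lambda>a. real a powr (- (p / 2))" for p
  by unfold_locales (auto split: if_splits)

lemma zeta_last_nonneg: "0 \<le> zeta_last p n a"
  unfolding zeta_last_def by (rule zeta.chain_sum_nonneg)

lemma gamma_last_nonneg: "0 \<le> gamma_last p n a"
  unfolding gamma_last_def by (rule gamma.chain_sum_nonneg)

lemma zeta_last_0: "zeta_last p 0 a = real a powr (- p)"
  by (simp add: zeta_last_def)

lemma zeta_last_Suc:
  "zeta_last p (Suc n) a = (\<Sum>k=1..<a. real a powr (- p) * (real a - real k) * zeta_last p n k)"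
proof -
  have "{b \<in> {1..a}. b < a} = {1..<a}" by auto
  then show ?thesis by (simp add: zeta_last_def sum_distrib_left mult.assoc)
qed

lemma gamma_last_0: "gamma_last p 0 a = real a powr (- (p / 2))"
  by (simp add: gamma_last_def)

lemma gamma_last_odd:
  "gamma_last p (Suc (2 * n)) b = real b powr (- (p / 2)) * (\<Sum>a=1..b. gamma_last p (2 * n) a)"
proof -
  have "{a \<in> {1..b}. a \<le> b} = {1..b}" by auto
  then show ?thesis by (simp add: gamma_last_def)
qed

lemma gamma_last_even_Suc:
  "gamma_last p (2 * Suc n) a = real a powr (- (p / 2)) * (\<Sum>b=1..<a. gamma_last p (Suc (2 * n)) b)"
proof -
  have "{b \<in> {1..a}. b < a} = {1..<a}" by auto
  then show ?thesis by (simp add: gamma_last_def)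
qed

text \<open>
  Two steps of the \<gamma>-recursion at once: summing out the entry b between two consecutive odd
  positions k and a brings the recursion into the form of \<open>zeta_last_Suc\<close>, with the sum of
  b powr (-p/2) over k \<le> b < a in place of a powr (-p/2) * (a - k).
\<close>

lemma gamma_last_even_step:
  "gamma_last p (2 * Suc n) a =
    (\<Sum>k=1..<a. real a powr (- (p / 2)) * (\<Sum>b=k..<a. real b powr (- (p / 2))) * gamma_last p (2 * n) k)"
proof -
  let ?s = "- (p / 2)"
  have "(\<Sum>b=1..<a. gamma_last p (Suc (2 * n)) b)
      = (\<Sum>b\<in>{1..<a}. \<Sum>k\<in>{k\<in>{1..<a}. k \<le> b}. real b powr ?s * gamma_last p (2 * n) k)"
    unfolding gamma_last_odd sum_distrib_left
    by (intro sum.cong) auto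
  also have "\<dots> = (\<Sum>k\<in>{1..<a}. \<Sum>b\<in>{b\<in>{1..<a}. k \<le> b}. real b powr ?s * gamma_last p (2 * n) k)"
    by (rule sum.swap_restrict) auto
  also have "\<dots> = (\<Sum>k=1..<a. (\<Sum>b=k..<a. real b powr ?s) * gamma_last p (2 * n) k)"
    unfolding sum_distrib_right by (intro sum.cong) auto
  finally have eq: "(\<Sum>b=1..<a. gamma_last p (Suc (2 * n)) b)
      = (\<Sum>k=1..<a. (\<Sum>b=k..<a. real b powr ?s) * gamma_last p (2 * n) k)" .
  show ?thesis unfolding gamma_last_even_Suc eq by (subst sum_distrib_left) (simp only: mult.assoc)
qed

text \<open>
  The entry b that is summed out satisfies b < a, so its weight is at least a powr (-p/2). Each
  step of the \<gamma>-recursion thus dominates the corresponding step of the \<zeta>-recursion.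
\<close>

lemma zeta_last_le_gamma_last:
  assumes "0 \<le> p"
  shows "zeta_last p n a \<le> gamma_last p (2 * n) a"
proof (induction n arbitrary: a)
  case 0
  then show ?case using assms
    by (cases "a = 0") (auto simp: zeta_last_0 gamma_last_0 intro!: powr_mono)
next
  case (Suc n)
  show ?case unfolding zeta_last_Suc gamma_last_even_step
  proof (rule sum_mono)
    fix k assume k: "k \<in> {1..<a}"
    have "real a powr (- p) * (real a - real k) = real a powr (- (p / 2)) * (\<Sum>b=k..<a. real a powr (- (p / 2)))"
      using k powr_add[of "real a" "- (p / 2)" "- (p / 2)"] by (simp add: of_nat_diff)
    also have "\<dots> \<le> real a powr (- (p / 2)) * (\<Sum>b=k..<a. real b powr (- (p / 2)))"
      using k assms by (intro mult_left_mono sum_mono powr_mono2') auto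
    finally have "real a powr (- p) * (real a - real k)
      \<le> real a powr (- (p / 2)) * (\<Sum>b=k..<a. real b powr (- (p / 2)))" .
    then show "real a powr (- p) * (real a - real k) * zeta_last p n k
      \<le> real a powr (- (p / 2)) * (\<Sum>b=k..<a. real b powr (- (p / 2))) * gamma_last p (2 * n) k"
      by (rule mult_mono[OF _ Suc.IH]) (auto intro!: zeta_last_nonneg mult_nonneg_nonneg sum_nonneg)
  qed
qed

text \<open>
  Here b \<ge> k is used instead: half of the weight of b is moved back to the preceding odd
  position k. The moves cancel along the tuple except at its last entry, which has received
  nothing; hence the factor a powr (p/2).
\<close>

lemma gamma_last_le_zeta_last:
  assumes "0 \<le> p" "1 \<le> a"
  shows "gamma_last p (2 * n) a \<le> real a powr (p / 2) * zeta_last p n a"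
  using assms(2)
proof (induction n arbitrary: a)
  case 0
  then show ?case by (simp add: zeta_last_0 gamma_last_0 flip: powr_add)
next
  case (Suc n)
  show ?case unfolding zeta_last_Suc gamma_last_even_step
      sum_distrib_left[where A = "{1..<a}" and r = "real a powr (p / 2)"]
  proof (rule sum_mono)
    fix k assume k: "k \<in> {1..<a}"
    let ?s = "p / 2"
    have "(\<Sum>b=k..<a. real b powr (- ?s)) \<le> (\<Sum>b=k..<a. real k powr (- ?s))"
      using k assms by (intro sum_mono powr_mono2') auto
    then have *: "(\<Sum>b=k..<a. real b powr (- ?s)) \<le> (real a - real k) * real k powr (- ?s)"
      using k by (simp add: of_nat_diff)
    have "real a powr (- ?s) * (\<Sum>b=k..<a. real b powr (- ?s)) * gamma_last p (2 * n) k
        \<le> real a powr (- ?s) * ((real a - real k) * real k powr (- ?s)) * (real k powr ?s * zeta_last p n k)"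
      using k by (intro mult_mono Suc.IH mult_left_mono * mult_nonneg_nonneg gamma_last_nonneg sum_nonneg) auto
    also have "\<dots> = real a powr (- ?s) * ((real a - real k) * zeta_last p n k) * (real k powr (- ?s) * real k powr ?s)"
      by (simp only: mult_ac)
    also have "\<dots> = (real a powr ?s * real a powr (- p)) * ((real a - real k) * zeta_last p n k)"
    proof -
      have "real k powr (- ?s) * real k powr ?s = 1" using k by (simp flip: powr_add)
      moreover have "real a powr (- ?s) = real a powr ?s * real a powr (- p)" by (simp flip: powr_add)
      ultimately show ?thesis by simp
    qed
    finally show "real a powr (- ?s) * (\<Sum>b=k..<a. real b powr (- ?s)) * gamma_last p (2 * n) k
      \<le> real a powr ?s * (real a powr (- p) * (real a - real k) * zeta_last p n k)"
      by (simp only: mult.assoc)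
  qed
qed

text \<open>
  The kernel of the \<zeta>-recursion is at most a powr (1 - p), and 1 - p = -1 - 2\<epsilon> for \<epsilon> = (p - 2)/2.
\<close>

lemma zeta_decay:
  assumes "2 < p"
  obtains C where "0 < C"
    and "\<And>n N. (\<Sum>a=1..N. zeta_last p (n + j) a)
          \<le> C * (\<Sum>k=1..N. real k powr (- (j * ((p - 2) / 2))) * zeta_last p n k)"
proof -
  have kernel: "real a powr (- p) * (real a - real k) \<le> 1 * real a powr (- 1 - 2 * ((p - 2) / 2))"
    if "1 \<le> k" "k < a" for k a :: nat
  proof -
    have "real a powr (- p) * (real a - real k) \<le> real a powr (- p) * real a powr 1"
      using that by (intro mult_left_mono) auto
    also have "\<dots> = real a powr (- 1 - 2 * ((p - 2) / 2))"
      unfolding powr_add[symmetric] by (rule arg_cong[where f = "(powr) (real a)"]) (simp add: field_simps)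
    finally show ?thesis by simp
  qed
  have pos: "0 < (p - 2) / 2" using assms by simp
  show ?thesis
    by (rule kernel_iteration_decay[of "zeta_last p",
          OF zeta_last_nonneg zeta_last_Suc kernel zero_le_one pos, where j = j]) (assumption | rule that)+
qed

text \<open>
  The sum over the intermediate entry is bounded by the convergent series of b powr (-p/2). What is
  left of the kernel is a powr (-p/2), and -p/2 = -1 - 2\<epsilon> for \<epsilon> = (p - 2)/4.
\<close>

lemma gamma_decay:
  assumes "2 < p"
  obtains C where "0 < C"
    and "\<And>n N. (\<Sum>a=1..N. gamma_last p (2 * (n + j)) a)
          \<le> C * (\<Sum>k=1..N. real k powr (- (j * ((p - 2) / 4))) * gamma_last p (2 * n) k)"
proof -
  obtain H where H: "0 \<le> H" "\<And>A. finite A \<Longrightarrow> (\<Sum>a\<in>A. real a powr (- (p / 2))) \<le> H"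
    using bounded_powr_sums[of "p / 2"] assms by auto
  have kernel: "real a powr (- (p / 2)) * (\<Sum>b=k..<a. real b powr (- (p / 2)))
      \<le> H * real a powr (- 1 - 2 * ((p - 2) / 4))" for k a :: nat
  proof -
    have "- (p / 2) = - 1 - 2 * ((p - 2) / 4)" by (simp add: field_simps)
    then show ?thesis using mult_left_mono[OF H(2), of "{k..<a}" "real a powr (- (p / 2))"]
      by (simp add: mult.commute)
  qed
  have pos: "0 < (p - 2) / 4" using assms by simp
  show ?thesis
    by (rule kernel_iteration_decay[of "\<lambda>n. gamma_last p (2 * n)",
          OF gamma_last_nonneg gamma_last_even_step kernel H(1) pos, where j = j]) (assumption | rule that)+
qed

text \<open>
  Keep only the tuples whose last two entries coincide.
\<close>

lemma gamma_partial_lower: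
  "(\<Sum>a=1..N. real a powr (- (p / 2)) * gamma_last p (2 * n) a) \<le> (\<Sum>b=1..N. gamma_last p (Suc (2 * n)) b)"
  unfolding gamma_last_odd
  by (intro sum_mono mult_left_mono member_le_sum) (auto intro: gamma_last_nonneg)

text \<open>
  Drop the condition that the final entry is at least its predecessor; its sum then converges
  on its own.
\<close>

lemma gamma_partial_upper:
  assumes "2 < p"
  obtains H where "0 < H"
    "\<And>n N. (\<Sum>b=1..N. gamma_last p (Suc (2 * n)) b) \<le> H * (\<Sum>a=1..N. gamma_last p (2 * n) a)"
proof -
  obtain H where H: "0 \<le> H" "\<And>A. finite A \<Longrightarrow> (\<Sum>a\<in>A. real a powr (- (p / 2))) \<le> H"
    using bounded_powr_sums[of "p / 2"] assms by auto
  have "(\<Sum>b=1..N. gamma_last p (Suc (2 * n)) b) \<le> (H + 1) * (\<Sum>a=1..N. gamma_last p (2 * n) a)" for n N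
  proof -
    have "(\<Sum>b=1..N. gamma_last p (Suc (2 * n)) b)
        \<le> (\<Sum>b=1..N. real b powr (- (p / 2)) * (\<Sum>a=1..N. gamma_last p (2 * n) a))"
      unfolding gamma_last_odd
      by (intro sum_mono mult_left_mono sum_mono2) (auto intro: gamma_last_nonneg)
    also have "\<dots> = (\<Sum>b=1..N. real b powr (- (p / 2))) * (\<Sum>a=1..N. gamma_last p (2 * n) a)"
      by (simp add: sum_distrib_right)
    also have "\<dots> \<le> (H + 1) * (\<Sum>a=1..N. gamma_last p (2 * n) a)"
      using H(2)[of "{1..N}"] by (intro mult_right_mono sum_nonneg gamma_last_nonneg) auto
    finally show ?thesis .
  qed
  then show ?thesis using H(1) by (intro that[of "H + 1"]) auto
qed

section \<open>Comparison of shifted coefficients\<close>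

text \<open>
  With j additional entries the \<zeta>-sum acquires the weight a powr (-j \<epsilon>). Once j \<epsilon> exceeds p/2,
  this is below the weight that the lower bound for the \<gamma>-sum carries.
\<close>

lemma zeta_partial_le_gamma_partial:
  assumes "2 < p"
  obtains C j where "0 < C"
    "\<And>n N. (\<Sum>a=1..N. zeta_last p (n + j) a) \<le> C * (\<Sum>b=1..N. gamma_last p (Suc (2 * n)) b)"
proof -
  obtain j :: nat where j: "p / 2 < j * ((p - 2) / 2)"
    using reals_Archimedean3[of "(p - 2) / 2"] assms by (metis diff_gt_0_iff_gt half_gt_zero)
  obtain C where C: "0 < C" "\<And>n N. (\<Sum>a=1..N. zeta_last p (n + j) a)
          \<le> C * (\<Sum>k=1..N. real k powr (- (j * ((p - 2) / 2))) * zeta_last p n k)"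
    using zeta_decay[OF assms, of j] by metis
  have "(\<Sum>a=1..N. zeta_last p (n + j) a) \<le> C * (\<Sum>b=1..N. gamma_last p (Suc (2 * n)) b)" for n N
  proof -
    have "(\<Sum>k=1..N. real k powr (- (j * ((p - 2) / 2))) * zeta_last p n k)
        \<le> (\<Sum>k=1..N. real k powr (- (p / 2)) * gamma_last p (2 * n) k)"
      using j assms by (intro sum_mono mult_mono powr_mono zeta_last_le_gamma_last zeta_last_nonneg) auto
    also have "\<dots> \<le> (\<Sum>b=1..N. gamma_last p (Suc (2 * n)) b)" by (rule gamma_partial_lower)
    finally show ?thesis using C(2)[of n N] mult_left_mono[of _ _ C] C(1) by (meson order_trans less_imp_le)
  qed
  then show ?thesis using C(1) that by blast
qed

text \<open>
  Again j is chosen such that the gain from j additional pairs of entries, of weight a powr (-j \<epsilon>),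
  compensates the factor a powr (p/2) by which \<Gamma>_n(a) may exceed Z_n(a).
\<close>

lemma gamma_partial_le_zeta_partial:
  assumes "2 < p"
  obtains C j where "0 < C"
    "\<And>n N. (\<Sum>b=1..N. gamma_last p (Suc (2 * (n + j))) b) \<le> C * (\<Sum>a=1..N. zeta_last p n a)"
proof -
  obtain j :: nat where j: "p / 2 < j * ((p - 2) / 4)"
    using reals_Archimedean3[of "(p - 2) / 4"] assms
    by (metis diff_gt_0_iff_gt divide_pos_pos zero_less_numeral)
  obtain C where C: "0 < C" "\<And>n N. (\<Sum>a=1..N. gamma_last p (2 * (n + j)) a)
          \<le> C * (\<Sum>k=1..N. real k powr (- (j * ((p - 2) / 4))) * gamma_last p (2 * n) k)"
    using gamma_decay[OF assms, of j] by metis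
  obtain H where H: "0 < H"
    "\<And>n N. (\<Sum>b=1..N. gamma_last p (Suc (2 * n)) b) \<le> H * (\<Sum>a=1..N. gamma_last p (2 * n) a)"
    using gamma_partial_upper[OF assms] by metis
  have "(\<Sum>b=1..N. gamma_last p (Suc (2 * (n + j))) b) \<le> H * C * (\<Sum>a=1..N. zeta_last p n a)" for n N
  proof -
    have "(\<Sum>k=1..N. real k powr (- (j * ((p - 2) / 4))) * gamma_last p (2 * n) k)
        \<le> (\<Sum>k=1..N. real k powr (- (p / 2)) * (real k powr (p / 2) * zeta_last p n k))"
      using j assms by (intro sum_mono mult_mono powr_mono gamma_last_le_zeta_last gamma_last_nonneg) auto
    also have "\<dots> = (\<Sum>k=1..N. zeta_last p n k)"
      by (intro sum.cong) (auto simp flip: powr_add mult.assoc)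
    finally have *: "(\<Sum>k=1..N. real k powr (- (j * ((p - 2) / 4))) * gamma_last p (2 * n) k) \<le> \<dots>" .
    have "(\<Sum>b=1..N. gamma_last p (Suc (2 * (n + j))) b) \<le> H * (\<Sum>a=1..N. gamma_last p (2 * (n + j)) a)"
      by (rule H(2))
    also have "\<dots> \<le> H * (C * (\<Sum>k=1..N. real k powr (- (j * ((p - 2) / 4))) * gamma_last p (2 * n) k))"
      using H(1) by (intro mult_left_mono C(2)) auto
    also have "\<dots> \<le> H * (C * (\<Sum>k=1..N. zeta_last p n k))"
      using H(1) C(1) by (intro mult_left_mono *) auto
    finally show ?thesis by (simp add: mult.assoc)
  qed
  then show ?thesis using C(1) H(1) that[of "H * C" j] by auto
qed

section \<open>Upper bound by an infinite product\<close>

text \<open>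
  For small y this is 1 + y \<le> exp y and y \<le> y powr \<delta>; for large y, both 2 and y are absorbed by
  exponentials of y powr \<delta>.
\<close>

lemma one_plus_le_exp_powr:
  fixes y \<delta> :: real
  assumes "0 \<le> y" "0 < \<delta>" "\<delta> \<le> 1"
  shows "1 + y \<le> exp ((1 + 1 / \<delta>) * y powr \<delta>)"
proof (cases "y \<le> 1")
  case True
  have "y \<le> y powr \<delta>"
  proof (cases "y = 0")
    case False
    then show ?thesis using powr_mono'[of \<delta> 1 y] True assms by auto
  qed auto
  also have "\<dots> \<le> (1 + 1 / \<delta>) * y powr \<delta>"
    using assms by (simp add: algebra_simps)
  finally have "1 + y \<le> 1 + (1 + 1 / \<delta>) * y powr \<delta>" by simp
  then show ?thesis using exp_ge_add_one_self order_trans by blast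
next
  case False
  then have y: "1 < y" by simp
  have ge1: "1 \<le> y powr \<delta>" using y assms by (simp add: ge_one_powr_ge_zero)
  have "y = exp (ln (y powr \<delta>) / \<delta>)" using y assms by (simp add: ln_powr)
  also have "\<dots> \<le> exp (y powr \<delta> / \<delta>)"
    using y assms by (intro exp_le_cancel_iff[THEN iffD2] divide_right_mono less_imp_le[OF ln_less_self]) auto
  finally have le: "y \<le> exp (y powr \<delta> / \<delta>)" .
  have "1 + y \<le> 2 * y" using y by simp
  also have "\<dots> \<le> exp (y powr \<delta>) * exp (y powr \<delta> / \<delta>)"
    using exp_ge_add_one_self[of "y powr \<delta>"] ge1 y by (intro mult_mono le) linarith+
  also have "\<dots> = exp ((1 + 1 / \<delta>) * y powr \<delta>)"
    by (simp add: algebra_simps flip: exp_add)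
  finally show ?thesis .
qed

text \<open>
  Write y_b = x * b powr (-p/2), so that P_b - P_{b-1} = y_b P_{b-1}. Each step of the recursion
  multiplies by y_b and sums; the sum is compared with a telescoping one. With the bounds chosen
  here a step from an even length to an odd one is y_b P_{b-1}^2 \<le> P_{b-1} P_b - P_{b-2} P_{b-1},
  and a step from an odd length to an even one is y_b P_{b-1} P_b \<le> P_b^2 - P_{b-1}^2.
  The bound P_{N-1} P_N for odd lengths, slightly better than P_N^2, is what makes the
  second kind of step close.
\<close>

lemma gamma_partial_le_product:
  fixes x p :: real
  assumes "0 \<le> x"
  defines "P \<equiv> \<lambda>N. \<Prod>k=1..N. 1 + x * real k powr (- (p / 2))"
  shows "x ^ Suc (2 * n) * (\<Sum>a=1..N. gamma_last p (2 * n) a) \<le> P (N - 1) * P N"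
    and "x ^ Suc (Suc (2 * n)) * (\<Sum>b=1..N. gamma_last p (Suc (2 * n)) b) \<le> P N * P N"
proof -
  define y where "y b = x * real b powr (- (p / 2))" for b :: nat
  have y: "0 \<le> y b" for b using assms by (simp add: y_def)
  have P_Suc: "P (Suc b) = P b + y (Suc b) * P b" for b
    by (simp add: P_def y_def algebra_simps)
  have P_ge: "1 \<le> P b" for b
    by (induction b) (use y in \<open>auto simp: P_Suc intro: order_trans add_increasing2, simp add: P_def\<close>)
  have P_mono: "P b \<le> P (Suc b)" for b
    using y[of "Suc b"] P_ge[of b] by (simp add: P_Suc)
  have telescope: "(\<Sum>b=1..N. f b) \<le> g N"
    if "\<And>b. f (Suc b) \<le> g (Suc b) - g b" "0 \<le> g 0" for f g :: "nat \<Rightarrow> real" and N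
    by (induction N) (use that in \<open>auto simp: algebra_simps intro: order_trans add_mono\<close>)
  have step_even: "(\<Sum>a=1..N. y a * h a) \<le> P (N - 1) * P N"
    if h: "\<And>b. h (Suc b) \<le> P b * P b" for h N
  proof (rule telescope[where g = "\<lambda>N. P (N - 1) * P N"])
    fix b
    have "y (Suc b) * h (Suc b) \<le> y (Suc b) * (P b * P b)" by (intro mult_left_mono h y)
    also have "\<dots> = P b * P (Suc b) - P b * P b" by (simp add: P_Suc algebra_simps)
    also have "\<dots> \<le> P b * P (Suc b) - P (b - 1) * P b"
      using P_mono[of "b - 1"] P_ge[of b] by (cases b) (auto intro!: mult_right_mono)
    finally show "y (Suc b) * h (Suc b) \<le> P (Suc b - 1) * P (Suc b) - P (b - 1) * P b" by simp
  qed (simp add: P_def)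
  have step_odd: "x ^ Suc (Suc (2 * n)) * (\<Sum>b=1..N. gamma_last p (Suc (2 * n)) b) \<le> P N * P N"
    if ih: "\<And>N. x ^ Suc (2 * n) * (\<Sum>a=1..N. gamma_last p (2 * n) a) \<le> P (N - 1) * P N" for n N
  proof -
    have "x ^ Suc (Suc (2 * n)) * (\<Sum>b=1..N. gamma_last p (Suc (2 * n)) b)
        = (\<Sum>b=1..N. y b * (x ^ Suc (2 * n) * (\<Sum>a=1..b. gamma_last p (2 * n) a)))"
      unfolding gamma_last_odd sum_distrib_left[where A = "{1..N}"] by (simp add: y_def mult_ac)
    also have "\<dots> \<le> P N * P N"
    proof (rule telescope[where g = "\<lambda>N. P N * P N"])
      fix b
      have "y (Suc b) * (x ^ Suc (2 * n) * (\<Sum>a=1..Suc b. gamma_last p (2 * n) a))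
          \<le> y (Suc b) * (P (Suc b - 1) * P (Suc b))"
        by (intro mult_left_mono ih y)
      also have "\<dots> = P (Suc b) * P (Suc b) - P b * P (Suc b)" by (simp add: P_Suc algebra_simps)
      also have "\<dots> \<le> P (Suc b) * P (Suc b) - P b * P b"
        using P_mono[of b] P_ge[of b] by (simp add: mult_left_mono)
      finally show "y (Suc b) * (x ^ Suc (2 * n) * (\<Sum>a=1..Suc b. gamma_last p (2 * n) a))
          \<le> P (Suc b) * P (Suc b) - P b * P b" .
    qed (simp add: P_def)
    finally show ?thesis .
  qed
  have even: "x ^ Suc (2 * n) * (\<Sum>a=1..N. gamma_last p (2 * n) a) \<le> P (N - 1) * P N" for n N
  proof (induction n arbitrary: N)
    case 0
    have "1 \<le> P b * P b" for b using mult_mono[OF P_ge P_ge, of b b] P_ge[of b] by simp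
    then have "(\<Sum>a=1..N. y a * 1) \<le> P (N - 1) * P N" by (intro step_even)
    then show ?case by (simp add: gamma_last_0 y_def sum_distrib_left)
  next
    case (Suc n)
    have "(\<Sum>a=1..N. y a * (x ^ Suc (Suc (2 * n)) * (\<Sum>b=1..<a. gamma_last p (Suc (2 * n)) b))) \<le> P (N - 1) * P N"
    proof (rule step_even)
      fix b
      show "x ^ Suc (Suc (2 * n)) * (\<Sum>c=1..<Suc b. gamma_last p (Suc (2 * n)) c) \<le> P b * P b"
        using step_odd[OF Suc.IH, of b] by (simp only: atLeastLessThanSuc_atLeastAtMost)
    qed
    moreover have "x ^ Suc (2 * Suc n) * (\<Sum>a=1..N. gamma_last p (2 * Suc n) a)
      = (\<Sum>a=1..N. y a * (x ^ Suc (Suc (2 * n)) * (\<Sum>b=1..<a. gamma_last p (Suc (2 * n)) b)))"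
      unfolding gamma_last_even_Suc sum_distrib_left[where A = "{1..N}"] by (simp add: y_def mult_ac)
    ultimately show ?case by simp
  qed
  show "x ^ Suc (2 * n) * (\<Sum>a=1..N. gamma_last p (2 * n) a) \<le> P (N - 1) * P N"
    by (rule even)
  show "x ^ Suc (Suc (2 * n)) * (\<Sum>b=1..N. gamma_last p (Suc (2 * n)) b) \<le> P N * P N"
    by (rule step_odd[OF even])
qed

text \<open>
  The product of the factors 1 + x k powr (-p/2) has order 2/p in x. For each exponent \<delta> > 2/p the
  logarithm of a factor is at most a multiple of (x k powr (-p/2)) powr \<delta>, and these terms are
  summable over k because \<delta> p/2 > 1.
\<close>

lemma gamma_partial_exp_bound:
  assumes "2 < p" "2 / p < \<delta>" "\<delta> \<le> 1"
  obtains K where "0 \<le> K"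
    "\<And>x n N. 0 \<le> x \<Longrightarrow> x ^ Suc (2 * n) * (\<Sum>a=1..N. gamma_last p (2 * n) a) \<le> exp (K * x powr \<delta>)"
    "\<And>x n N. 0 \<le> x \<Longrightarrow>
       x ^ Suc (Suc (2 * n)) * (\<Sum>b=1..N. gamma_last p (Suc (2 * n)) b) \<le> exp (K * x powr \<delta>)"
proof -
  have d: "0 < \<delta>" using assms by (smt (verit) divide_pos_pos)
  have "1 < p / 2 * \<delta>" using assms by (simp add: field_simps)
  then obtain H where H: "0 \<le> H" "\<And>A. finite A \<Longrightarrow> (\<Sum>a\<in>A. real a powr (- (p / 2 * \<delta>))) \<le> H"
    using bounded_powr_sums by blast
  define K where "K = (1 + 1 / \<delta>) * H"
  have K: "0 \<le> K" using H(1) d by (simp add: K_def)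
  define P where "P x N = (\<Prod>k=1..N. 1 + x * real k powr (- (p / 2)))" for x N
  have P0: "0 \<le> P x N" if "0 \<le> x" for x N unfolding P_def using that by (intro prod_nonneg) auto
  have P: "P x N \<le> exp (K * x powr \<delta>)" if x: "0 \<le> x" for x N
  proof -
    have "P x N \<le> (\<Prod>k=1..N. exp ((1 + 1 / \<delta>) * (x * real k powr (- (p / 2))) powr \<delta>))"
      unfolding P_def using assms d x
      by (intro prod_mono conjI one_plus_le_exp_powr add_nonneg_nonneg mult_nonneg_nonneg) auto
    also have "\<dots> = exp ((1 + 1 / \<delta>) * x powr \<delta> * (\<Sum>k=1..N. real k powr (- (p / 2 * \<delta>))))"
      using x by (simp add: powr_mult powr_powr exp_sum sum_distrib_left mult.assoc)
    also have "\<dots> \<le> exp ((1 + 1 / \<delta>) * x powr \<delta> * H)"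
      using d H(2)[of "{1..N}"] by (intro exp_le_cancel_iff[THEN iffD2] mult_left_mono) auto
    finally show ?thesis by (simp add: K_def mult_ac)
  qed
  have PP: "P x M * P x N \<le> exp (2 * K * x powr \<delta>)" if x: "0 \<le> x" for x M N
  proof -
    have "P x M * P x N \<le> exp (K * x powr \<delta>) * exp (K * x powr \<delta>)"
      using x by (intro mult_mono P P0) auto
    then show ?thesis by (simp add: mult.assoc flip: exp_add)
  qed
  show ?thesis
  proof (rule that[of "2 * K"])
    show "0 \<le> 2 * K" using K by simp
  next
    fix x :: real and n N assume x: "0 \<le> x"
    show "x ^ Suc (2 * n) * (\<Sum>a=1..N. gamma_last p (2 * n) a) \<le> exp (2 * K * x powr \<delta>)"
      using gamma_partial_le_product(1)[OF x, of n p N] PP[OF x, of "N - 1" N] unfolding P_def by linarith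
    show "x ^ Suc (Suc (2 * n)) * (\<Sum>b=1..N. gamma_last p (Suc (2 * n)) b) \<le> exp (2 * K * x powr \<delta>)"
      using gamma_partial_le_product(2)[OF x, of n p N] PP[OF x, of N N] unfolding P_def by linarith
  qed
qed

text \<open>
  The contribution of the tuple (1, 2, ..., n + 1), all of whose differences are 1.
\<close>

lemma zeta_last_lower: "fact (Suc n) powr (- p) \<le> zeta_last p n (Suc n)"
proof (induction n)
  case 0
  then show ?case by (simp add: zeta_last_0)
next
  case (Suc n)
  have "fact (Suc (Suc n)) powr (- p) = real (Suc (Suc n)) powr (- p) * fact (Suc n) powr (- p)"
    by (subst fact_Suc) (simp add: powr_mult)
  also have "\<dots> \<le> real (Suc (Suc n)) powr (- p) * (real (Suc (Suc n)) - real (Suc n)) * zeta_last p n (Suc n)"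
    using Suc by (simp add: mult_left_mono)
  also have "\<dots> \<le> zeta_last p (Suc n) (Suc (Suc n))"
    unfolding zeta_last_Suc
    by (rule member_le_sum[where f = "\<lambda>k. real (Suc (Suc n)) powr (- p) * (real (Suc (Suc n)) - real k) * zeta_last p n k"])
       (auto intro!: mult_nonneg_nonneg zeta_last_nonneg)
  finally show ?case .
qed

section \<open>From truncated sums to the coefficients\<close>

lemma zeta_partial_bounded:
  assumes "2 < p"
  shows "\<exists>B. \<forall>N. (\<Sum>a=1..N. zeta_last p n a) \<le> B"
proof -
  have lt: "2 / p < 1" using assms by simp
  obtain K where "\<And>x n N. 0 \<le> x \<Longrightarrow> x ^ Suc (2 * n) * (\<Sum>a=1..N. gamma_last p (2 * n) a) \<le> exp (K * x powr 1)"
    using gamma_partial_exp_bound[OF assms lt order_refl] by metis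
  from this[of 1] have "(\<Sum>a=1..N. gamma_last p (2 * n) a) \<le> exp K" for N by simp
  moreover have "(\<Sum>a=1..N. zeta_last p n a) \<le> (\<Sum>a=1..N. gamma_last p (2 * n) a)" for N
    using assms by (intro sum_mono zeta_last_le_gamma_last) auto
  ultimately show ?thesis by (meson order_trans)
qed

lemma gamma_partial_bounded:
  assumes "2 < p"
  shows "\<exists>B. \<forall>N. (\<Sum>b=1..N. gamma_last p (Suc (2 * n)) b) \<le> B"
proof -
  have lt: "2 / p < 1" using assms by simp
  obtain K where "\<And>x n N. 0 \<le> x \<Longrightarrow>
       x ^ Suc (Suc (2 * n)) * (\<Sum>b=1..N. gamma_last p (Suc (2 * n)) b) \<le> exp (K * x powr 1)"
    using gamma_partial_exp_bound[OF assms lt order_refl] by metis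
  from this[of 1] show ?thesis by (intro exI[of _ "exp K"]) simp
qed

lemma zeta_coeff_partial:
  assumes "2 < p"
  shows "zeta_term (Suc n) p summable_on zeta_indices (Suc n)"
    and "(\<Sum>a=1..N. zeta_last p n a) \<le> zeta_coeff (Suc n) p"
    and "(\<And>N. (\<Sum>a=1..N. zeta_last p n a) \<le> B) \<Longrightarrow> zeta_coeff (Suc n) p \<le> B"
proof -
  let ?w = "chain_weight (\<lambda>x y. real y - real x) (\<lambda>a. real a powr (- p)) (Suc n)"
  have ind: "zeta_indices (Suc n) = chain_indices (\<lambda>_. (<)) (Suc n)"
    by (simp add: zeta_indices_def chain_indices_def)
  have wt: "zeta_term (Suc n) p = ?w"
    by (intro ext) (simp add: zeta_term_def chain_weight_def prod_powr_distrib del: prod.cl_ivl_Suc)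
  obtain B' where B': "\<And>N. (\<Sum>a=1..N. zeta_last p n a) \<le> B'"
    using zeta_partial_bounded[OF assms] by blast
  note bd = zeta.chain_summable[of p n, folded zeta_last_def ind wt]
  from bd(1,3)[OF B'] bd(2)[of B]
  show "zeta_term (Suc n) p summable_on zeta_indices (Suc n)"
    "(\<Sum>a=1..N. zeta_last p n a) \<le> zeta_coeff (Suc n) p"
    "(\<And>N. (\<Sum>a=1..N. zeta_last p n a) \<le> B) \<Longrightarrow> zeta_coeff (Suc n) p \<le> B"
    unfolding zeta_coeff_def by auto
qed

text \<open>
  The two families of inequalities are those at the odd and at the even positions of one chain.
\<close>

lemma gamma_indices_eq: "gamma_indices n = chain_indices (\<lambda>i. if odd i then (\<le>) else (<)) (2 * n)"
proof -
  have "(\<forall>i\<in>{1..<2 * n}. (if odd i then (\<le>) else (<)) (k i) (k (i + 1))) \<longleftrightarrow>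
     (\<forall>j\<in>{1..n}. k (2 * j - 1) \<le> k (2 * j)) \<and> (\<forall>j\<in>{1..<n}. k (2 * j) < k (2 * j + 1))"
    (is "?L \<longleftrightarrow> ?R") for k :: "nat \<Rightarrow> nat"
  proof
    assume L: ?L
    have "k (2 * j - 1) \<le> k (2 * j)" if "j \<in> {1..n}" for j
      using L[rule_format, of "2 * j - 1"] that by (cases j) auto
    moreover have "k (2 * j) < k (2 * j + 1)" if "j \<in> {1..<n}" for j
      using L[rule_format, of "2 * j"] that by auto
    ultimately show ?R by blast
  next
    assume R: ?R
    show ?L
    proof
      fix i assume i: "i \<in> {1..<2 * n}"
      show "(if odd i then (\<le>) else (<)) (k i) (k (i + 1))"
      proof (cases "odd i")
        case True
        then obtain j where "i = 2 * j + 1" by (elim oddE)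
        then show ?thesis using i R[THEN conjunct1, rule_format, of "Suc j"] by auto
      next
        case False
        then obtain j where "i = 2 * j" by (auto elim: evenE)
        then show ?thesis using i R[THEN conjunct2, rule_format, of j] by auto
      qed
    qed
  qed
  then show ?thesis unfolding gamma_indices_def chain_indices_def by auto
qed

lemma gamma_coeff_partial:
  assumes "2 < p"
  shows "gamma_term (Suc n) p summable_on gamma_indices (Suc n)"
    and "(\<Sum>b=1..N. gamma_last p (Suc (2 * n)) b) \<le> gamma_coeff (Suc n) p"
    and "(\<And>N. (\<Sum>b=1..N. gamma_last p (Suc (2 * n)) b) \<le> B) \<Longrightarrow> gamma_coeff (Suc n) p \<le> B"
proof -
  let ?w = "chain_weight (\<lambda>_ _. 1) (\<lambda>a. real a powr (- (p / 2))) (Suc (Suc (2 * n)))"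
  have ind: "gamma_indices (Suc n) = chain_indices (\<lambda>i. if odd i then (\<le>) else (<)) (Suc (Suc (2 * n)))"
    by (simp add: gamma_indices_eq)
  have wt: "gamma_term (Suc n) p = ?w"
    by (intro ext) (simp add: gamma_term_def chain_weight_def prod_powr_distrib del: prod.cl_ivl_Suc)
  obtain B' where B': "\<And>N. (\<Sum>b=1..N. gamma_last p (Suc (2 * n)) b) \<le> B'"
    using gamma_partial_bounded[OF assms] by blast
  note bd = gamma.chain_summable[of p "Suc (2 * n)", folded gamma_last_def ind wt]
  from bd(1,3)[OF B'] bd(2)[of B]
  show "gamma_term (Suc n) p summable_on gamma_indices (Suc n)"
    "(\<Sum>b=1..N. gamma_last p (Suc (2 * n)) b) \<le> gamma_coeff (Suc n) p"
    "(\<And>N. (\<Sum>b=1..N. gamma_last p (Suc (2 * n)) b) \<le> B) \<Longrightarrow> gamma_coeff (Suc n) p \<le> B"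
    unfolding gamma_coeff_def by auto
qed

section \<open>Entire functions with nonnegative coefficients\<close>

text \<open>
  Boundedness of the terms for every radius is enough for the series to be entire: compare with
  the terms for twice the radius. The index m witnesses that the series is not identically
  zero, and as 0 is not in the index set the function is then not constant.
\<close>

locale nonneg_entire_series =
  fixes A :: "nat set" and c :: "nat \<Rightarrow> real" and m :: nat
  assumes nonneg: "\<And>n. n \<in> A \<Longrightarrow> 0 \<le> c n"
    and zero_notin: "0 \<notin> A"
    and leading: "m \<in> A" "0 < c m"
    and bounded_terms: "\<And>r. 0 \<le> r \<Longrightarrow> \<exists>M. \<forall>n\<in>A. c n * r ^ n \<le> M"
begin

definition real_series :: "real \<Rightarrow> real" where
  "real_series r = (\<Sum>\<^sub>\<infinity>n\<in>A. c n * r ^ n)"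

definition complex_series :: "complex \<Rightarrow> complex" where
  "complex_series z = (\<Sum>\<^sub>\<infinity>n\<in>A. complex_of_real (c n) * z ^ n)"

lemma bounded_by_geometric:
  assumes "0 \<le> r" "\<And>n. n \<in> A \<Longrightarrow> c n * (2 * r) ^ n \<le> M"
  shows "(\<lambda>n. c n * r ^ n) summable_on A" and "real_series r \<le> 2 * M"
proof -
  have "0 \<le> M" using assms leading nonneg[of m]
    by (meson mult_nonneg_nonneg order_trans zero_le_power zero_le_mult_iff zero_le_numeral)
  have geo: "((\<lambda>n. M * (1 / 2) ^ n) has_sum (2 * M)) UNIV"
    using sums_mult[OF geometric_sums[of "1 / 2 :: real"], of M] \<open>0 \<le> M\<close>
    by (intro sums_nonneg_imp_has_sum) (auto simp: mult.commute)
  have le: "c n * r ^ n \<le> M * (1 / 2) ^ n" if "n \<in> A" for n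
    using assms(2)[OF that] by (simp add: power_mult_distrib field_simps)
  have geoA: "(\<lambda>n. M * (1 / 2) ^ n) summable_on A"
    using geo by (meson has_sum_imp_summable subset_UNIV summable_on_subset)
  show sm: "(\<lambda>n. c n * r ^ n) summable_on A"
    by (rule summable_on_comparison_test[OF geoA]) (use le nonneg assms(1) in auto)
  have "real_series r \<le> (\<Sum>\<^sub>\<infinity>n\<in>A. M * (1 / 2) ^ n)"
    unfolding real_series_def by (rule infsum_mono[OF sm geoA le])
  also have "\<dots> \<le> (\<Sum>\<^sub>\<infinity>n. M * (1 / 2) ^ n)"
    using geo geoA \<open>0 \<le> M\<close> by (intro infsum_mono_neutral) (auto intro: has_sum_imp_summable)
  also have "\<dots> = 2 * M" using geo by (rule infsumI)
  finally show "real_series r \<le> 2 * M" .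
qed

lemma summable_real: "0 \<le> r \<Longrightarrow> (\<lambda>n. c n * r ^ n) summable_on A"
  using bounded_terms[of "2 * r"] bounded_by_geometric(1)[of r] by auto

lemma norm_term: "n \<in> A \<Longrightarrow> norm (complex_of_real (c n) * z ^ n) = c n * norm z ^ n"
  using nonneg by (simp add: norm_mult norm_power)

lemma abs_summable: "(\<lambda>n. norm (complex_of_real (c n) * z ^ n)) summable_on A"
  using summable_real[of "norm z"] by (simp add: norm_term cong: summable_on_cong)

lemma summable: "(\<lambda>n. complex_of_real (c n) * z ^ n) summable_on A"
  using abs_summable by (rule abs_summable_summable)

lemma real_series_lower: "0 \<le> r \<Longrightarrow> n \<in> A \<Longrightarrow> c n * r ^ n \<le> real_series r"
  unfolding real_series_def using finite_sum_le_infsum[OF summable_real, of r "{n}"] nonneg by auto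

lemma sum_le_real_series: "0 \<le> r \<Longrightarrow> finite B \<Longrightarrow> B \<subseteq> A \<Longrightarrow> (\<Sum>n\<in>B. c n * r ^ n) \<le> real_series r"
  unfolding real_series_def using nonneg by (intro finite_sum_le_infsum summable_real) auto

lemma real_series_ge_leading: "1 \<le> r \<Longrightarrow> c m \<le> real_series r"
  using real_series_lower[of r m] leading mult_left_mono[OF one_le_power[of r m], of "c m"] by linarith

lemma real_series_pos: "1 \<le> r \<Longrightarrow> 0 < real_series r"
  using real_series_ge_leading leading(2) by fastforce

lemma complex_series_of_real:
  assumes "0 \<le> r"
  shows "complex_series (complex_of_real r) = complex_of_real (real_series r)"
proof -
  have "((\<lambda>n. complex_of_real (c n * r ^ n)) has_sum complex_of_real (real_series r)) A"
    unfolding has_sum_of_real_iff real_series_def using summable_real[OF assms] by (rule has_sum_infsum)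
  then show ?thesis unfolding complex_series_def by (simp add: infsumI)
qed

lemma max_modulus_eq: "0 \<le> r \<Longrightarrow> max_modulus complex_series r = real_series r"
proof -
  assume r: "0 \<le> r"
  have le: "cmod (complex_series z) \<le> real_series r" if "z \<in> sphere 0 r" for z
  proof -
    have "cmod (complex_series z) \<le> (\<Sum>\<^sub>\<infinity>n\<in>A. norm (complex_of_real (c n) * z ^ n))"
      unfolding complex_series_def by (rule norm_infsum_bound) (rule abs_summable)
    also have "\<dots> = real_series r" unfolding real_series_def using that by (intro infsum_cong) (simp add: norm_term)
    finally show ?thesis .
  qed
  have "0 \<le> real_series r" unfolding real_series_def using nonneg r by (intro infsum_nonneg) auto
  then have "real_series r = cmod (complex_series (complex_of_real r))" using r by (simp add: complex_series_of_real)
  moreover have "complex_of_real r \<in> sphere 0 r" using r by simp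
  ultimately show ?thesis unfolding max_modulus_def using le
    by (intro cSup_eq_maximum) (auto simp del: mem_sphere_0)
qed

lemma holomorphic: "complex_series holomorphic_on UNIV"
proof -
  let ?b = "\<lambda>n. if n \<in> A then complex_of_real (c n) else 0"
  have sums: "(\<lambda>n. ?b n * (z - 0) ^ n) sums complex_series z" for z
  proof -
    have "((\<lambda>n. complex_of_real (c n) * z ^ n) has_sum complex_series z) A"
      unfolding complex_series_def using summable by (rule has_sum_infsum)
    then have "((\<lambda>n. ?b n * (z - 0) ^ n) has_sum complex_series z) UNIV"
      by (rule has_sum_cong_neutral[THEN iffD1, rotated -1]) auto
    then show ?thesis by (rule has_sum_imp_sums)
  qed
  have "complex_series holomorphic_on ball 0 r" for r
    by (rule power_series_holomorphic) (rule sums)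
  then have "complex_series field_differentiable at z" for z
    using holomorphic_on_imp_differentiable_at[of complex_series "ball 0 (norm z + 1)" z] by simp
  then show ?thesis by (simp add: holomorphic_on_def field_differentiable_at_within)
qed

lemma not_constant: "\<not> complex_series constant_on UNIV"
proof
  assume "complex_series constant_on UNIV"
  then have "complex_series 0 = complex_series (complex_of_real 1)" by (auto simp: constant_on_def)
  moreover have "complex_series 0 = 0" unfolding complex_series_def using zero_notin
    by (intro infsum_0) (auto simp: power_0_left)
  ultimately show False 
    using real_series_pos[of 1] complex_series_of_real[of 1] by simp
qed

end

text \<open>
  A shift of the indices by j costs a factor r^j. The finitely many terms below k, to which the
  hypothesis does not apply, are at most a constant times r^k, and the other series is bounded
  below by a positive constant for r \<ge> 1.
\<close>

lemma shifted_coeffs_imp_series_le: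
  assumes "nonneg_entire_series A c m" "nonneg_entire_series B d l"
    and shift: "\<And>n. n \<in> A \<Longrightarrow> k \<le> n \<Longrightarrow> n - j \<in> B \<and> c n \<le> C * d (n - j)"
    and "0 \<le> C" "j \<le> k"
  obtains C' where "0 < C'"
    "\<And>r. 1 \<le> r \<Longrightarrow> nonneg_entire_series.real_series A c r \<le> C' * r ^ k * nonneg_entire_series.real_series B d r"
proof -
  interpret c: nonneg_entire_series A c m by fact
  interpret d: nonneg_entire_series B d l by fact
  define D where "D = (\<Sum>n\<in>A \<inter> {..<k}. c n)"
  have D: "0 \<le> D" unfolding D_def by (auto intro: sum_nonneg c.nonneg)
  have "c.real_series r \<le> (D / d l + C + 1) * r ^ k * d.real_series r" if r: "1 \<le> r" for r
  proof -
    have "c.real_series r \<le> D * r ^ k + C * r ^ k * d.real_series r"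
      unfolding c.real_series_def
    proof (rule infsum_le_finite_sums[OF c.summable_real])
      fix E assume E: "finite E" "E \<subseteq> A"
      have low: "(\<Sum>n\<in>E \<inter> {..<k}. c n * r ^ n) \<le> D * r ^ k"
      proof -
        have "(\<Sum>n\<in>E \<inter> {..<k}. c n * r ^ n) \<le> (\<Sum>n\<in>E \<inter> {..<k}. c n * r ^ k)"
          using E r c.nonneg by (intro sum_mono mult_left_mono power_increasing) auto
        also have "\<dots> \<le> (\<Sum>n\<in>A \<inter> {..<k}. c n * r ^ k)"
          using E r c.nonneg by (intro sum_mono2) auto
        finally show ?thesis by (simp add: D_def sum_distrib_right)
      qed
      have inj: "inj_on (\<lambda>n. n - j) (E \<inter> {k..})"
        using \<open>j \<le> k\<close> by (auto simp: inj_on_def)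
      have "(\<Sum>n\<in>E \<inter> {k..}. c n * r ^ n) \<le> (\<Sum>n\<in>E \<inter> {k..}. C * r ^ j * (d (n - j) * r ^ (n - j)))"
      proof (rule sum_mono)
        fix n assume n: "n \<in> E \<inter> {k..}"
        have "r ^ n = r ^ j * r ^ (n - j)" using n \<open>j \<le> k\<close> by (simp flip: power_add)
        moreover have "c n * r ^ n \<le> (C * d (n - j)) * r ^ n"
          using n shift[of n] E r by (intro mult_right_mono) auto
        ultimately show "c n * r ^ n \<le> C * r ^ j * (d (n - j) * r ^ (n - j))" by (simp only: mult_ac)
      qed
      also have "\<dots> = C * r ^ j * (\<Sum>n\<in>(\<lambda>n. n - j) ` (E \<inter> {k..}). d n * r ^ n)"
        by (simp add: sum.reindex[OF inj] sum_distrib_left)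
      also have "\<dots> \<le> C * r ^ k * d.real_series r"
        using E shift r \<open>0 \<le> C\<close> \<open>j \<le> k\<close> d.nonneg
        by (intro mult_mono d.sum_le_real_series power_increasing mult_nonneg_nonneg sum_nonneg) auto
      finally have high: "(\<Sum>n\<in>E \<inter> {k..}. c n * r ^ n) \<le> C * r ^ k * d.real_series r" .
      have "(\<Sum>n\<in>E. c n * r ^ n) = (\<Sum>n\<in>(E \<inter> {..<k}) \<union> (E \<inter> {k..}). c n * r ^ n)"
        by (intro sum.cong) auto
      also have "\<dots> = (\<Sum>n\<in>E \<inter> {..<k}. c n * r ^ n) + (\<Sum>n\<in>E \<inter> {k..}. c n * r ^ n)"
        using E by (intro sum.union_disjoint) auto
      finally show "(\<Sum>n\<in>E. c n * r ^ n) \<le> D * r ^ k + C * r ^ k * d.real_series r"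
        using low high by simp
    qed (use r in simp)
    also have "D * r ^ k \<le> D / d l * r ^ k * d.real_series r"
    proof -
      have "D * r ^ k * d l \<le> D * r ^ k * d.real_series r"
        using D r by (intro mult_left_mono d.real_series_ge_leading) auto
      then show ?thesis using d.leading by (simp add: field_simps)
    qed
    also have "D / d l * r ^ k * d.real_series r + C * r ^ k * d.real_series r \<le> (D / d l + C + 1) * r ^ k * d.real_series r"
      using r d.real_series_pos[of r] by (simp add: algebra_simps)
    finally show ?thesis by simp
  qed
  moreover have "0 < D / d l + C + 1" using D d.leading \<open>0 \<le> C\<close> by (intro add_nonneg_pos add_nonneg_nonneg) auto
  ultimately show ?thesis using that by blast
qed

section \<open>Growth on the logarithmic scale\<close>

lemma ln_diff_bigo_ln:
  fixes F G :: "real \<Rightarrow> real"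
  assumes "\<And>r. 1 \<le> r \<Longrightarrow> 0 < F r" "\<And>r. 1 \<le> r \<Longrightarrow> 0 < G r"
    and "0 < C" "\<And>r. 1 \<le> r \<Longrightarrow> F r \<le> C * r ^ k * G r"
    and "0 < D" "\<And>r. 1 \<le> r \<Longrightarrow> G r \<le> D * r ^ l * F r"
  shows "(\<lambda>r. ln (F r) - ln (G r)) \<in> O(\<lambda>r. ln r)"
proof (rule bigoI)
  define B where "B = \<bar>ln C\<bar> + \<bar>ln D\<bar> + k + l"
  show "\<forall>\<^sub>F r in at_top. norm (ln (F r) - ln (G r)) \<le> B * norm (ln r)"
    using eventually_ge_at_top[of "exp 1"]
  proof eventually_elim
    case (elim r)
    have r: "1 \<le> r" using elim exp_ge_add_one_self[of 1] by linarith
    have ln: "1 \<le> ln r" using elim r ln_ge_iff[of r 1] by auto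
    have "ln (F r) \<le> ln (C * r ^ k * G r)" using assms r by (simp add: less_le_trans)
    also have "\<dots> = ln C + k * ln r + ln (G r)"
      using assms(2)[OF r] assms(3) r by (simp add: ln_mult ln_realpow)
    finally have 1: "ln (F r) - ln (G r) \<le> \<bar>ln C\<bar> * 1 + k * ln r" by simp
    have "ln (G r) \<le> ln (D * r ^ l * F r)" using assms r by (simp add: less_le_trans)
    also have "\<dots> = ln D + l * ln r + ln (F r)"
      using assms(1)[OF r] assms(5) r by (simp add: ln_mult ln_realpow)
    finally have 2: "ln (G r) - ln (F r) \<le> \<bar>ln D\<bar> * 1 + l * ln r" by simp
    have "\<bar>ln C\<bar> * 1 \<le> \<bar>ln C\<bar> * ln r" "\<bar>ln D\<bar> * 1 \<le> \<bar>ln D\<bar> * ln r"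
      using ln by (intro mult_left_mono; simp)+
    moreover have "0 \<le> k * ln r" "0 \<le> l * ln r" "0 \<le> \<bar>ln C\<bar> * ln r" "0 \<le> \<bar>ln D\<bar> * ln r"
      using ln by auto
    ultimately have "\<bar>ln (F r) - ln (G r)\<bar> \<le> B * ln r"
      using 1 2 unfolding B_def distrib_right by linarith
    then show ?case using ln by simp
  qed
qed

lemma growth_exponent_from_bounds:
  fixes U :: "real \<Rightarrow> real"
  assumes "0 < \<rho>" "0 < a" and lower: "\<forall>\<^sub>F r in at_top. a * r powr \<rho> \<le> U r"
    and upper: "\<And>\<eta>. \<rho> < \<eta> \<Longrightarrow> U \<in> O(\<lambda>r. r powr \<eta>)"
  shows "((\<lambda>r. ln (U r) / ln r) \<longlongrightarrow> \<rho>) at_top"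
proof (rule order_tendstoI)
  fix x assume x: "x < \<rho>"
  have "((\<lambda>r. \<rho> + ln a / ln r) \<longlongrightarrow> \<rho> + 0) at_top"
    by (intro tendsto_intros real_tendsto_divide_at_top[OF tendsto_const] ln_at_top)
  then have "\<forall>\<^sub>F r in at_top. x < \<rho> + ln a / ln r" using x by (simp add: order_tendstoD)
  with lower eventually_gt_at_top[of 1] show "\<forall>\<^sub>F r in at_top. x < ln (U r) / ln r"
  proof eventually_elim
    case (elim r)
    have pos: "0 < a * r powr \<rho>" using assms elim by simp
    have "ln a + \<rho> * ln r = ln (a * r powr \<rho>)" using assms elim by (simp add: ln_mult ln_powr)
    also have "\<dots> \<le> ln (U r)" using pos elim by simp
    finally have "(ln a + \<rho> * ln r) / ln r \<le> ln (U r) / ln r"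
      using elim by (intro divide_right_mono) auto
    moreover have "(ln a + \<rho> * ln r) / ln r = \<rho> + ln a / ln r" using elim by (simp add: field_simps)
    ultimately have "\<rho> + ln a / ln r \<le> ln (U r) / ln r" by simp
    then show ?case using elim by linarith
  qed
next
  fix x assume x: "\<rho> < x"
  define \<eta> where "\<eta> = (\<rho> + x) / 2"
  have \<eta>: "\<rho> < \<eta>" "\<eta> < x" using x by (auto simp: \<eta>_def)
  obtain K where K: "0 < K" "\<forall>\<^sub>F r in at_top. norm (U r) \<le> K * norm (r powr \<eta>)"
    using landau_o.bigE[OF upper[OF \<eta>(1)]] by blast
  have "((\<lambda>r. \<eta> + ln K / ln r) \<longlongrightarrow> \<eta> + 0) at_top"
    by (intro tendsto_intros real_tendsto_divide_at_top[OF tendsto_const] ln_at_top)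
  then have "\<forall>\<^sub>F r in at_top. \<eta> + ln K / ln r < x" using \<eta> by (simp add: order_tendstoD)
  with lower K(2) eventually_gt_at_top[of 1] show "\<forall>\<^sub>F r in at_top. ln (U r) / ln r < x"
  proof eventually_elim
    case (elim r)
    have "0 < a * r powr \<rho>" using assms elim by simp
    then have "0 < U r" using elim by linarith
    then have "ln (U r) \<le> ln (K * r powr \<eta>)" using elim by simp
    also have "\<dots> = ln K + \<eta> * ln r" using K elim by (simp add: ln_mult ln_powr)
    finally have "ln (U r) / ln r \<le> \<eta> + ln K / ln r" using elim by (simp add: field_simps)
    then show ?case using elim by linarith
  qed
qed

lemma ln_smallo_powr: "0 < \<rho> \<Longrightarrow> (\<lambda>r::real. ln r) \<in> o(\<lambda>r. r powr \<rho>)"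
  by real_asymp

text \<open>
  A perturbation of size O(ln r) is o(r powr \<rho>) for \<rho> > 0. So it affects neither lower bounds
  nor upper bounds of power type, apart from constants, nor the normalised limit that defines the type.
\<close>

lemma log_perturbation:
  fixes U V :: "real \<Rightarrow> real"
  assumes UV: "(\<lambda>r. U r - V r) \<in> O(\<lambda>r. ln r)" and "0 < \<rho>"
  shows "0 < a \<Longrightarrow> \<forall>\<^sub>F r in at_top. a * r powr \<rho> \<le> V r \<Longrightarrow> \<forall>\<^sub>F r in at_top. a / 2 * r powr \<rho> \<le> U r"
    and "V \<in> O(\<lambda>r. r powr \<rho>) \<Longrightarrow> U \<in> O(\<lambda>r. r powr \<rho>)"
    and "((\<lambda>r. U r / r powr \<rho> - V r / r powr \<rho>) \<longlongrightarrow> 0) at_top"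
proof -
  have small: "(\<lambda>r. U r - V r) \<in> o(\<lambda>r. r powr \<rho>)"
    using UV ln_smallo_powr[OF \<open>0 < \<rho>\<close>] by (rule landau_o.big_small_trans)
  show "\<forall>\<^sub>F r in at_top. a / 2 * r powr \<rho> \<le> U r"
    if "0 < a" "\<forall>\<^sub>F r in at_top. a * r powr \<rho> \<le> V r"
  proof -
    have "\<forall>\<^sub>F r in at_top. norm (U r - V r) \<le> a / 2 * norm (r powr \<rho>)"
      using landau_o.smallD[OF small, of "a / 2"] that(1) by simp
    with that(2) show ?thesis
    proof eventually_elim
      case (elim r)
      have "\<bar>U r - V r\<bar> \<le> a * r powr \<rho> / 2" using elim by simp
      then have "a * r powr \<rho> / 2 \<le> U r" using elim by linarith
      then show ?case by simp
    qed
  qed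
  show "U \<in> O(\<lambda>r. r powr \<rho>)" if "V \<in> O(\<lambda>r. r powr \<rho>)"
    using sum_in_bigo(1)[OF landau_o.small_imp_big[OF small] that] by simp
  have "((\<lambda>r. (U r - V r) / r powr \<rho>) \<longlongrightarrow> 0) at_top"
    using small by (rule smalloD_tendsto)
  then show "((\<lambda>r. U r / r powr \<rho> - V r / r powr \<rho>) \<longlongrightarrow> 0) at_top"
    by (simp add: diff_divide_distrib)
qed

lemma Limsup_ereal_le_of_diff_tendsto_0:
  fixes u v :: "'a \<Rightarrow> real"
  assumes "((\<lambda>x. u x - v x) \<longlongrightarrow> 0) F"
  shows "Limsup F (\<lambda>x. ereal (u x)) \<le> Limsup F (\<lambda>x. ereal (v x))"
proof (rule ccontr)
  assume "\<not> ?thesis"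
  then obtain y where y: "Limsup F (\<lambda>x. ereal (v x)) < ereal y" "ereal y < Limsup F (\<lambda>x. ereal (u x))"
    using ereal_dense2 by (meson not_le)
  then obtain y' where y': "ereal y < ereal y'" "ereal y' < Limsup F (\<lambda>x. ereal (u x))"
    using ereal_dense2 by blast
  have "\<forall>\<^sub>F x in F. ereal (v x) < ereal y" using y(1) by (rule Limsup_lessD)
  moreover have "\<forall>\<^sub>F x in F. u x - v x < y' - y" using assms y'(1) by (simp add: order_tendstoD)
  ultimately have "\<forall>\<^sub>F x in F. ereal (u x) \<le> ereal y'" by eventually_elim auto
  then have "Limsup F (\<lambda>x. ereal (u x)) \<le> ereal y'" by (rule Limsup_bounded)
  with y'(2) show False by simp
qed

lemma Limsup_ereal_eq_of_diff_tendsto_0: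
  fixes u v :: "'a \<Rightarrow> real"
  assumes "((\<lambda>x. u x - v x) \<longlongrightarrow> 0) F"
  shows "Limsup F (\<lambda>x. ereal (u x)) = Limsup F (\<lambda>x. ereal (v x))"
proof (rule antisym)
  have "((\<lambda>x. v x - u x) \<longlongrightarrow> 0) F" using tendsto_minus[OF assms] by simp
  then show "Limsup F (\<lambda>x. ereal (v x)) \<le> Limsup F (\<lambda>x. ereal (u x))"
    by (rule Limsup_ereal_le_of_diff_tendsto_0)
qed (rule Limsup_ereal_le_of_diff_tendsto_0[OF assms])

section \<open>Order and type\<close>

text \<open>
  The product bound with x = sqrt r: a tuple for \<gamma>_n has 2n entries, and x^(2n) = r^n.
\<close>

lemma gamma_coeff_bound:
  assumes "2 < p" "1 / p < \<eta>" "\<eta> \<le> 1 / 2"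
  obtains K where "0 \<le> K" "\<And>n r. 1 \<le> n \<Longrightarrow> 0 \<le> r \<Longrightarrow> gamma_coeff n p * r ^ n \<le> exp (K * r powr \<eta>)"
proof -
  have "2 / p < 2 * \<eta>" "2 * \<eta> \<le> 1" using assms by auto
  from gamma_partial_exp_bound[OF assms(1) this]
  obtain K where K: "0 \<le> K" "\<And>x n N. 0 \<le> x \<Longrightarrow>
       x ^ Suc (Suc (2 * n)) * (\<Sum>b=1..N. gamma_last p (Suc (2 * n)) b) \<le> exp (K * x powr (2 * \<eta>))"
    by metis
  have "gamma_coeff n p * r ^ n \<le> exp (K * r powr \<eta>)" if "1 \<le> n" "0 \<le> r" for n r
  proof (cases "r = 0")
    case False
    then have r: "0 < r" using that by simp
    define k where "k = n - 1"
    have k: "n = Suc k" using that by (simp add: k_def)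
    have "sqrt r ^ Suc (Suc (2 * k)) = (sqrt r ^ 2) ^ n"
      unfolding k power_mult[symmetric] by simp
    then have 1: "sqrt r ^ Suc (Suc (2 * k)) = r ^ n" using r by simp
    have 2: "sqrt r powr (2 * \<eta>) = r powr \<eta>" using r by (simp add: powr_half_sqrt[symmetric] powr_powr)
    have "gamma_coeff (Suc k) p \<le> exp (K * r powr \<eta>) / r ^ n"
      using K(2)[of "sqrt r" k] r
      by (intro gamma_coeff_partial(3) assms(1)) (simp only: 1 2, simp add: field_simps)
    then show ?thesis using r k by (simp add: field_simps)
  qed (use that in \<open>simp add: power_0_left\<close>)
  then show ?thesis using K(1) that by blast
qed

text \<open>
  A crude bound suffices here, since it only serves to make the \<zeta>-series entire. It comes from
  Z_n(a) \<le> \<Gamma>_n(a) and the product bound for odd lengths, whence the extra factor sqrt r.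
\<close>

lemma zeta_coeff_bound:
  assumes "2 < p"
  obtains K where "\<And>n r. 1 \<le> n \<Longrightarrow> 0 \<le> r \<Longrightarrow> zeta_coeff n p * r ^ n \<le> sqrt r * exp (K * sqrt r)"
proof -
  have lt: "2 / p < 1" using assms by simp
  obtain K where K: "\<And>x n N. 0 \<le> x \<Longrightarrow>
       x ^ Suc (2 * n) * (\<Sum>a=1..N. gamma_last p (2 * n) a) \<le> exp (K * x powr 1)"
    using gamma_partial_exp_bound[OF assms lt order_refl] by metis
  have "zeta_coeff n p * r ^ n \<le> sqrt r * exp (K * sqrt r)" if "1 \<le> n" "0 \<le> r" for n r
  proof (cases "r = 0")
    case False
    then have r: "0 < r" using that by simp
    define k where "k = n - 1"
    have k: "n = Suc k" using that by (simp add: k_def)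
    have "sqrt r * sqrt r ^ Suc (2 * k) = (sqrt r ^ 2) ^ n"
      unfolding k power_mult[symmetric] by simp
    then have 1: "sqrt r * sqrt r ^ Suc (2 * k) = r ^ n" using r by simp
    have "zeta_coeff (Suc k) p \<le> sqrt r * exp (K * sqrt r) / r ^ n"
    proof (rule zeta_coeff_partial(3)[OF assms])
      fix N
      have "(\<Sum>a=1..N. zeta_last p k a) * r ^ n \<le> (\<Sum>a=1..N. gamma_last p (2 * k) a) * r ^ n"
        using assms r by (intro mult_right_mono sum_mono zeta_last_le_gamma_last) auto
      also have "\<dots> = sqrt r * (sqrt r ^ Suc (2 * k) * (\<Sum>a=1..N. gamma_last p (2 * k) a))"
        unfolding 1[symmetric] by (simp only: mult_ac)
      also have "\<dots> \<le> sqrt r * exp (K * sqrt r powr 1)"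
        using r by (intro mult_left_mono K) auto
      finally show "(\<Sum>a=1..N. zeta_last p k a) \<le> sqrt r * exp (K * sqrt r) / r ^ n"
        using r by (simp add: field_simps)
    qed
    then show ?thesis using r k by (simp add: field_simps)
  qed (use that in \<open>simp add: power_0_left\<close>)
  then show ?thesis using that by blast
qed

lemma zeta_coeff_lower:
  assumes "2 < p" "1 \<le> n"
  shows "fact n powr (- p) \<le> zeta_coeff n p"
proof -
  obtain k where k: "n = Suc k" using assms by (cases n) auto
  have "fact n powr (- p) \<le> zeta_last p k (Suc k)" unfolding k by (rule zeta_last_lower)
  also have "\<dots> \<le> (\<Sum>a=1..Suc k. zeta_last p k a)"
    by (rule member_le_sum) (auto simp: zeta_last_nonneg)
  also have "\<dots> \<le> zeta_coeff n p" unfolding k by (rule zeta_coeff_partial(2)[OF assms(1)])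
  finally show ?thesis .
qed

lemma gamma_coeff_nonneg: "0 \<le> gamma_coeff n p"
  unfolding gamma_coeff_def gamma_term_def by (intro infsum_nonneg) auto

lemma gamma_coeff_1_pos:
  assumes "2 < p"
  shows "0 < gamma_coeff 1 p"
proof -
  have "gamma_last p (Suc (2 * 0)) 1 = 1" unfolding gamma_last_odd by (simp add: gamma_last_0)
  then show ?thesis using gamma_coeff_partial(2)[OF assms, where n=0 and N=1] by simp
qed

lemma entire_zeta:
  assumes "2 < p"
  shows "nonneg_entire_series {2..} (\<lambda>n. zeta_coeff n p) 2"
proof
  fix r :: real assume r: "0 \<le> r"
  obtain K where "\<And>n r. 1 \<le> n \<Longrightarrow> 0 \<le> r \<Longrightarrow> zeta_coeff n p * r ^ n \<le> sqrt r * exp (K * sqrt r)"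
    using zeta_coeff_bound[OF assms] by metis
  then show "\<exists>M. \<forall>n\<in>{2..}. zeta_coeff n p * r ^ n \<le> M"
    using r by (intro exI[of _ "sqrt r * exp (K * sqrt r)"]) auto
next
  have pos: "0 < zeta_coeff n p" if "1 \<le> n" for n
    using zeta_coeff_lower[OF assms that] by (rule less_le_trans[rotated]) simp
  show "0 < zeta_coeff 2 p" by (rule pos) simp
  show "0 \<le> zeta_coeff n p" if "n \<in> {2..}" for n
    using that by (intro less_imp_le pos) auto
qed auto

lemma entire_gamma:
  assumes "2 < p"
  shows "nonneg_entire_series {1..} (\<lambda>n. gamma_coeff n p) 1"
proof
  fix r :: real assume r: "0 \<le> r"
  have "1 / p < 1 / 2" using assms by simp
  then obtain K where "\<And>n r. 1 \<le> n \<Longrightarrow> 0 \<le> r \<Longrightarrow> gamma_coeff n p * r ^ n \<le> exp (K * r powr (1 / 2))"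
    using gamma_coeff_bound[OF assms _ order_refl] by metis
  then show "\<exists>M. \<forall>n\<in>{1..}. gamma_coeff n p * r ^ n \<le> M"
    using r by (intro exI[of _ "exp (K * r powr (1 / 2))"]) auto
qed (use gamma_coeff_1_pos[OF assms] in \<open>auto simp: gamma_coeff_nonneg\<close>)

lemma zeta_coeff_shift_le:
  assumes "2 < p"
  obtains C j where "0 < C" "\<And>n. 1 \<le> n \<Longrightarrow> zeta_coeff (n + j) p \<le> C * gamma_coeff n p"
proof -
  obtain C j where C: "0 < C"
    "\<And>n N. (\<Sum>a=1..N. zeta_last p (n + j) a) \<le> C * (\<Sum>b=1..N. gamma_last p (Suc (2 * n)) b)"
    using zeta_partial_le_gamma_partial[OF assms] by metis
  have "zeta_coeff (Suc k + j) p \<le> C * gamma_coeff (Suc k) p" for k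
    unfolding add_Suc
    by (rule zeta_coeff_partial(3)[OF assms], rule order_trans[OF C(2)])
       (use C(1) in \<open>intro mult_left_mono gamma_coeff_partial(2) assms; simp\<close>)
  then show ?thesis using C(1) by (intro that[of C j]) (auto dest!: Suc_le_D)
qed

lemma gamma_coeff_shift_le:
  assumes "2 < p"
  obtains C j where "0 < C" "\<And>n. 1 \<le> n \<Longrightarrow> gamma_coeff (n + j) p \<le> C * zeta_coeff n p"
proof -
  obtain C j where C: "0 < C"
    "\<And>n N. (\<Sum>b=1..N. gamma_last p (Suc (2 * (n + j))) b) \<le> C * (\<Sum>a=1..N. zeta_last p n a)"
    using gamma_partial_le_zeta_partial[OF assms] by metis
  have "gamma_coeff (Suc k + j) p \<le> C * zeta_coeff (Suc k) p" for k
    unfolding add_Suc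
    by (rule gamma_coeff_partial(3)[OF assms], rule order_trans[OF C(2)])
       (use C(1) in \<open>intro mult_left_mono zeta_coeff_partial(2) assms; simp\<close>)
  then show ?thesis using C(1) by (intro that[of C j]) (auto dest!: Suc_le_D)
qed

text \<open>
  Use a single term, with n close to R/e for R = r powr (1/p): by n! \<le> n^n \<le> (R/e)^n it is at least
  exp(p n).
\<close>

lemma ln_lower_of_factorial_coeffs:
  fixes F :: "real \<Rightarrow> real"
  assumes "0 < p" and F: "\<And>n r. 2 \<le> n \<Longrightarrow> 0 \<le> r \<Longrightarrow> fact n powr (- p) * r ^ n \<le> F r"
  shows "\<forall>\<^sub>F r in at_top. p / (2 * exp 1) * r powr (1 / p) \<le> ln (F r)"
proof -
  have "filterlim (\<lambda>r::real. r powr (1 / p)) at_top at_top"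
    using assms(1) by real_asymp
  then have "\<forall>\<^sub>F r in at_top. 3 * exp 1 \<le> r powr (1 / p)"
    by (simp add: filterlim_at_top)
  with eventually_gt_at_top[of 0] show ?thesis
  proof eventually_elim
    case (elim r)
    define R where "R = r powr (1 / p)"
    define n where "n = nat \<lfloor>R / exp 1\<rfloor>"
    have R: "3 \<le> R / exp 1" "0 < R" using elim by (auto simp: R_def field_simps)
    have n: "real n \<le> R / exp 1" "R / exp 1 - 1 < real n"
      using R unfolding n_def by linarith+
    then have n2: "2 \<le> n" using R by linarith
    have r: "r = R powr p" using elim assms by (simp add: R_def powr_powr)
    have "fact n \<le> real n ^ n" using fact_le_power[where 'a = real, of n] by simp
    also have "\<dots> \<le> (R / exp 1) ^ n" using n by (intro power_mono) auto
    finally have "fact n \<le> (R / exp 1) ^ n" .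
    then have "((R / exp 1) ^ n) powr (- p) \<le> fact n powr (- p)"
      using assms by (intro powr_mono2') auto
    then have "((R / exp 1) ^ n) powr (- p) * r ^ n \<le> F r"
      using F[OF n2, of r] elim by (meson less_imp_le mult_right_mono order_trans zero_le_power)
    also have "((R / exp 1) ^ n) powr (- p) * r ^ n = exp (p * n)"
    proof -
      have "((R / exp 1) ^ n) powr (- p) = exp (- p * (n * (ln R - 1)))"
        using R by (simp add: powr_def ln_realpow ln_div)
      moreover have "r ^ n = exp (n * (p * ln R))" using R by (simp add: r powr_def exp_of_nat_mult)
      ultimately show ?thesis by (simp add: algebra_simps flip: exp_add)
    qed
    finally have le: "exp (p * n) \<le> F r" .
    have half: "x / 2 \<le> real n" if "x - 1 < real n" "3 \<le> x" for x using that by linarith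
    have "p / (2 * exp 1) * R = p * (R / exp 1 / 2)" by simp
    also have "\<dots> \<le> p * n" using assms(1) by (intro mult_left_mono half[OF n(2) R(1)]) simp
    also have "\<dots> \<le> ln (F r)" using le by (metis exp_gt_zero less_le_trans ln_ge_iff)
    finally show ?case by (simp add: R_def)
  qed
qed

theorem corollary1p9:
  fixes p :: real
  assumes "p > 2"
  shows "(\<forall>n\<ge>2. zeta_term n p summable_on zeta_indices n) \<and>
         (\<forall>n\<ge>1. gamma_term n p summable_on gamma_indices n) \<and>
         (\<forall>z::complex. (\<lambda>n. complex_of_real (zeta_coeff n p) * z ^ n) summable_on {2..}) \<and>
         (\<forall>z::complex. (\<lambda>n. complex_of_real (gamma_coeff n p) * z ^ n) summable_on {1..}) \<and>
         Z_fun p holomorphic_on UNIV \<and> \<not> Z_fun p constant_on UNIV \<and>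
         G_fun p holomorphic_on UNIV \<and> \<not> G_fun p constant_on UNIV \<and>
         growth_order (Z_fun p) = ereal (1 / p) \<and>
         growth_order (G_fun p) = ereal (1 / p) \<and>
         growth_type (Z_fun p) = growth_type (G_fun p)"
proof -
  interpret Z: nonneg_entire_series "{2..}" "\<lambda>n. zeta_coeff n p" 2 by (rule entire_zeta[OF assms])
  interpret G: nonneg_entire_series "{1..}" "\<lambda>n. gamma_coeff n p" 1 by (rule entire_gamma[OF assms])
  have Z_eq: "Z_fun p = Z.complex_series" by (rule ext) (simp only: Z_fun_def Z.complex_series_def)
  have G_eq: "G_fun p = G.complex_series" by (rule ext) (simp only: G_fun_def G.complex_series_def)
  define U where "U = (\<lambda>r. ln (Z.real_series r))"
  define V where "V = (\<lambda>r. ln (G.real_series r))"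
  have p: "0 < 1 / p" "1 / p < 1 / 2" using assms by auto

  obtain C j where C: "0 < C" "\<And>n. 1 \<le> n \<Longrightarrow> zeta_coeff (n + j) p \<le> C * gamma_coeff n p"
    using zeta_coeff_shift_le[OF assms] by metis
  obtain C' where C': "0 < C'" "\<And>r. 1 \<le> r \<Longrightarrow> Z.real_series r \<le> C' * r ^ (j + 2) * G.real_series r"
  proof (rule shifted_coeffs_imp_series_le[OF Z.nonneg_entire_series_axioms G.nonneg_entire_series_axioms, of "j + 2" j C])
    fix n assume "n \<in> {2..}" "j + 2 \<le> n"
    then show "n - j \<in> {1..} \<and> zeta_coeff n p \<le> C * gamma_coeff (n - j) p"
      using C(2)[of "n - j"] by simp
  qed (use C(1) in auto)
  obtain D i where D: "0 < D" "\<And>n. 1 \<le> n \<Longrightarrow> gamma_coeff (n + i) p \<le> D * zeta_coeff n p"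
    using gamma_coeff_shift_le[OF assms] by metis
  obtain D' where D': "0 < D'" "\<And>r. 1 \<le> r \<Longrightarrow> G.real_series r \<le> D' * r ^ (i + 2) * Z.real_series r"
  proof (rule shifted_coeffs_imp_series_le[OF G.nonneg_entire_series_axioms Z.nonneg_entire_series_axioms, of "i + 2" i D])
    fix n assume "n \<in> {1::nat..}" "i + 2 \<le> n"
    then show "n - i \<in> {2..} \<and> gamma_coeff n p \<le> D * zeta_coeff (n - i) p"
      using D(2)[of "n - i"] by auto
  qed (use D(1) in auto)
  have UV: "(\<lambda>r. U r - V r) \<in> O(\<lambda>r. ln r)"
    unfolding U_def V_def by (rule ln_diff_bigo_ln[OF Z.real_series_pos G.real_series_pos C' D'])
  have VU: "(\<lambda>r. V r - U r) \<in> O(\<lambda>r. ln r)"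
    unfolding U_def V_def by (rule ln_diff_bigo_ln[OF G.real_series_pos Z.real_series_pos D' C'])

  have a: "0 < p / (2 * exp 1)" using assms by simp
  have U_lower: "\<forall>\<^sub>F r in at_top. p / (2 * exp 1) * r powr (1 / p) \<le> U r"
    unfolding U_def
  proof (rule ln_lower_of_factorial_coeffs)
    fix n :: nat and r :: real assume "2 \<le> n" "0 \<le> r"
    then show "fact n powr (- p) * r ^ n \<le> Z.real_series r"
      using zeta_coeff_lower[OF assms, of n]
      by (intro order_trans[OF mult_right_mono Z.real_series_lower]) auto
  qed (use assms in simp)
  have V_lower: "\<forall>\<^sub>F r in at_top. p / (2 * exp 1) / 2 * r powr (1 / p) \<le> V r"
    by (rule log_perturbation(1)[OF VU p(1) a U_lower])

  have V_upper: "V \<in> O(\<lambda>r. r powr \<eta>)" if \<eta>: "1 / p < \<eta>" for \<eta>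
  proof -
    \<comment> \<open>the coefficient bound requires an exponent of at most 1/2; larger ones follow from it\<close>
    define \<theta> where "\<theta> = min \<eta> (1 / 2)"
    have \<theta>: "1 / p < \<theta>" "\<theta> \<le> 1 / 2" "\<theta> \<le> \<eta>" using \<eta> p by (auto simp: \<theta>_def)
    obtain K where K: "0 \<le> K" "\<And>n r. 1 \<le> n \<Longrightarrow> 0 \<le> r \<Longrightarrow> gamma_coeff n p * r ^ n \<le> exp (K * r powr \<theta>)"
      using gamma_coeff_bound[OF assms \<theta>(1,2)] by metis
    have upper: "V r \<le> ln 2 + K * (2 * r) powr \<theta>" if "1 \<le> r" for r
    proof -
      have "G.real_series r \<le> 2 * exp (K * (2 * r) powr \<theta>)"
        using that by (intro G.bounded_by_geometric(2) K(2)) auto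
      then have "V r \<le> ln (2 * exp (K * (2 * r) powr \<theta>))"
        unfolding V_def using G.real_series_pos[OF that] by simp
      then show ?thesis by (simp add: ln_mult)
    qed
    have "V \<in> O(\<lambda>r. ln 2 + K * (2 * r) powr \<theta>)"
    proof (rule bigoI[where c = 1])
      show "\<forall>\<^sub>F r in at_top. norm (V r) \<le> 1 * norm (ln 2 + K * (2 * r) powr \<theta>)"
        using V_lower eventually_ge_at_top[of 1]
      proof eventually_elim
        case (elim r)
        have "0 \<le> p / (2 * exp 1) / 2 * r powr (1 / p)" using assms by simp
        then have "0 \<le> V r" using elim by linarith
        then show ?case using upper[OF elim(2)] by simp
      qed
    qed
    also have "(\<lambda>r. ln 2 + K * (2 * r) powr \<theta>) \<in> O(\<lambda>r. r powr \<eta>)"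
    proof (rule sum_in_bigo)
      have "0 < \<eta>" using \<eta> p by linarith
      then show "(\<lambda>r. ln 2) \<in> O(\<lambda>r::real. r powr \<eta>)" by real_asymp
      have "(\<lambda>r. K * (2 * r) powr \<theta>) \<in> O(\<lambda>r. r powr \<theta>)"
        by (rule bigoI[where c = "K * 2 powr \<theta>"], rule eventually_mono[OF eventually_ge_at_top[of 0]])
           (use K(1) in \<open>simp add: powr_mult\<close>)
      also have "(\<lambda>r::real. r powr \<theta>) \<in> O(\<lambda>r. r powr \<eta>)"
        using \<theta>(3) by (intro bigoI[where c = 1] eventually_mono[OF eventually_ge_at_top[of 1]])
          (auto intro: powr_mono)
      finally show "(\<lambda>r. K * (2 * r) powr \<theta>) \<in> O(\<lambda>r. r powr \<eta>)" .
    qed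
    finally show ?thesis .
  qed
  have U_upper: "U \<in> O(\<lambda>r. r powr \<eta>)" if "1 / p < \<eta>" for \<eta>
    using log_perturbation(2)[OF UV _ V_upper[OF that]] that p by linarith

  \<comment> \<open>the two bounds give a genuine limit, which is then also the limit superior\<close>
  have order: "growth_order (nonneg_entire_series.complex_series A c) = ereal (1 / p)"
    if S: "nonneg_entire_series A c m"
      and b: "0 < b" "\<forall>\<^sub>F r in at_top. b * r powr (1 / p) \<le> ln (nonneg_entire_series.real_series A c r)"
      and up: "\<And>\<eta>. 1 / p < \<eta> \<Longrightarrow> (\<lambda>r. ln (nonneg_entire_series.real_series A c r)) \<in> O(\<lambda>r. r powr \<eta>)"
    for A c m b
  proof -
    interpret S: nonneg_entire_series A c m by (rule S)
    have "((\<lambda>r. ln (ln (S.real_series r)) / ln r) \<longlongrightarrow> 1 / p) at_top"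
      by (rule growth_exponent_from_bounds[OF p(1) b up])
    moreover have "\<forall>\<^sub>F r in at_top. ln (ln (S.real_series r)) / ln r = ln (ln (max_modulus S.complex_series r)) / ln r"
      using eventually_ge_at_top[of 0] by eventually_elim (simp add: S.max_modulus_eq)
    ultimately have "((\<lambda>r. ln (ln (max_modulus S.complex_series r)) / ln r) \<longlongrightarrow> 1 / p) at_top"
      by (rule Lim_transform_eventually)
    then show ?thesis unfolding growth_order_def
      by (intro lim_imp_Limsup) (auto simp: trivial_limit_at_top_linorder)
  qed
  have Z_order: "growth_order Z.complex_series = ereal (1 / p)"
    by (rule order[OF Z.nonneg_entire_series_axioms a U_lower[unfolded U_def] U_upper[unfolded U_def]])
  have G_order: "growth_order G.complex_series = ereal (1 / p)"
    by (rule order[OF G.nonneg_entire_series_axioms _ V_lower[unfolded V_def] V_upper[unfolded V_def]]) (use a in simp_all)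

  have "growth_type Z.complex_series = Limsup at_top (\<lambda>r. ereal (U r / r powr (1 / p)))"
    unfolding growth_type_def Z_order
    by (intro Limsup_eq eventually_mono[OF eventually_ge_at_top[of 0]]) (simp only: U_def Z.max_modulus_eq real_of_ereal.simps)
  also have "\<dots> = Limsup at_top (\<lambda>r. ereal (V r / r powr (1 / p)))"
    by (rule Limsup_ereal_eq_of_diff_tendsto_0[OF log_perturbation(3)[OF UV p(1)]])
  also have "\<dots> = growth_type G.complex_series"
    unfolding growth_type_def G_order
    by (intro Limsup_eq eventually_mono[OF eventually_ge_at_top[of 0]]) (simp only: V_def G.max_modulus_eq real_of_ereal.simps)
  finally have type: "growth_type Z.complex_series = growth_type G.complex_series" .

  have "zeta_term n p summable_on zeta_indices n" if "2 \<le> n" for n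
    using zeta_coeff_partial(1)[OF assms, of "n - 1"] that by simp
  moreover have "gamma_term n p summable_on gamma_indices n" if "1 \<le> n" for n
    using gamma_coeff_partial(1)[OF assms, of "n - 1"] that by simp
  ultimately show ?thesis
    unfolding Z_eq G_eq
    using Z.summable G.summable Z.holomorphic G.holomorphic Z.not_constant G.not_constant Z_order G_order type
    by blast
qed

end
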